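(* Let $\Delta,r\in\mathbb{Z}_{\ge 2}$ with $r\ge \Delta+1$, and let $N_\Delta$ be the number of integer partitions of $\Delta-1$. There are at least $N_\Delta+1$ pairwise non-isomorphic simple rank-$r$, $\Delta$-modular matroids with exactly $\binom{r+1}{2}+(\Delta-1)(r-1)$ elements.
   Context: An integer matrix $\mathbf{A}$ is $\Delta$-modular if every $\operatorname{rank}(\mathbf{A})\times\operatorname{rank}(\mathbf{A})$ submatrix has determinant of absolute value at most $\Delta$. A matroid is $\Delta$-modular if it is isomorphic to the (column) vector matroid over $\mathbb{R}$ of some $\Delta$-modular matrix. *)

theory Defs
  imports
    "HOL-Library.Multiset"
    "Jordan_Normal_Form.DL_Rank"
    "Jordan_Normal_Form.DL_Submatrix"
begin

section \<open>Matroids\<close>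

record 'a indep_system =
  ground :: "'a set"
  indeps :: "'a set set"

locale matroid =
  fixes M :: "'a indep_system"
  assumes finite_ground: "finite (ground M)"
    and indeps_subset: "indeps M \<subseteq> Pow (ground M)"
    and empty_indep: "{} \<in> indeps M"
    and indep_mono: "X \<in> indeps M \<Longrightarrow> Y \<subseteq> X \<Longrightarrow> Y \<in> indeps M"
    and augmentation: "X \<in> indeps M \<Longrightarrow> Y \<in> indeps M \<Longrightarrow> card X < card Y
      \<Longrightarrow> \<exists>y \<in> Y - X. insert y X \<in> indeps M"

definition matroid_rank :: "'a indep_system \<Rightarrow> nat" where
  "matroid_rank M = Max (card ` indeps M)"

definition circuit :: "'a indep_system \<Rightarrow> 'a set \<Rightarrow> bool" where
  "circuit M C \<longleftrightarrow> C \<subseteq> ground M \<and> C \<notin> indeps M \<and> (\<forall>D. D \<subset> C \<longrightarrow> D \<in> indeps M)"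

text \<open>A matroid is simple if it has neither loops nor pairs of parallel elements.\<close>

definition simple_matroid :: "'a indep_system \<Rightarrow> bool" where
  "simple_matroid M \<longleftrightarrow> (\<forall>e. \<not> circuit M {e}) \<and> (\<forall>e f. e \<noteq> f \<longrightarrow> \<not> circuit M {e, f})"

definition matroid_iso :: "'a indep_system \<Rightarrow> 'b indep_system \<Rightarrow> bool" where
  "matroid_iso M N \<longleftrightarrow> (\<exists>f. bij_betw f (ground M) (ground N) \<and>
     (\<forall>X. X \<subseteq> ground M \<longrightarrow> (X \<in> indeps M \<longleftrightarrow> f ` X \<in> indeps N)))"

section \<open>Vector matroids and \<open>\<Delta>\<close>-modularity\<close>

text \<open>
  The ground set consists of the column indices, so repeated columns are distinct (parallel)
  elements. A set of indices is independent if the corresponding family of columns is; the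
  injectivity condition is needed because linear dependence in the library is a property of
  sets of vectors, not of families.
\<close>

definition vector_matroid :: "real mat \<Rightarrow> nat indep_system" where
  "vector_matroid A = \<lparr>
     ground = {..<dim_col A},
     indeps = {J. J \<subseteq> {..<dim_col A} \<and> inj_on (col A) J \<and>
       \<not> LinearCombinations.module.lin_dep class_ring (module_vec TYPE(real) (dim_row A)) (col A ` J)} \<rparr>"

definition mat_rank :: "int mat \<Rightarrow> nat" where
  "mat_rank A = vec_space.rank (dim_row A) (map_mat real_of_int A)"

definition modular_mat :: "nat \<Rightarrow> int mat \<Rightarrow> bool" where
  "modular_mat \<Delta> A \<longleftrightarrow> (\<forall>I J. I \<subseteq> {..<dim_row A} \<longrightarrow> J \<subseteq> {..<dim_col A} \<longrightarrow>
     card I = mat_rank A \<longrightarrow> card J = mat_rank A \<longrightarrow>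
     \<bar>Determinant.det (submatrix A I J)\<bar> \<le> int \<Delta>)"

definition modular_matroid :: "nat \<Rightarrow> 'a indep_system \<Rightarrow> bool" where
  "modular_matroid \<Delta> M \<longleftrightarrow>
     (\<exists>A. modular_mat \<Delta> A \<and> matroid_iso M (vector_matroid (map_mat real_of_int A)))"

section \<open>Integer partitions\<close>

text \<open>A partition of \<open>n\<close> is a multiset of positive integers with sum \<open>n\<close>.\<close>

definition num_partitions :: "nat \<Rightarrow> nat" where
  "num_partitions n = card {P :: nat multiset. 0 \<notin># P \<and> sum_mset P = n}"

end

theory Submission
  imports Defs
begin

text \<open>
  Give the vertices \<open>0, \<dots>, r - 1\<close> weights \<open>c\<close> with \<open>c 0 = 0\<close> and total weight \<open>\<Delta>\<close>, and join
  \<open>i < j\<close> by edges of all integer gains from \<open>- c j\<close> to \<open>c i\<close>. The columns are the incidence vectors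
  of these edges, extended by a coordinate for the gain, and one further column, the apex, for that
  coordinate. A maximal minor is up to sign the gain of a cycle, and a cycle leaves every vertex
  at most once, so the minor is at most \<open>\<Delta>\<close> in absolute value. A line with at least four points passes
  through the apex and consists of it and all edges between two vertices \<open>i\<close> and \<open>j\<close>; it has
  \<open>c i + c j + 2\<close> points. Hence the matroid determines the sums \<open>c i + c j\<close> that are at least 2, then
  (from the total weight) all pair sums, and then, since the minimal weight is known to be 0, the multiset
  of weights. So different partitions of \<open>\<Delta>\<close> give non-isomorphic matroids, and among the partitions of
  \<open>\<Delta>\<close> are the partitions of \<open>\<Delta> - 1\<close> with an additional part 1 and the partition with the single part \<open>\<Delta>\<close>.
\<close>

section \<open>Linearly independent families\<close>

text \<open>Families instead of sets of vectors: repeated vectors count as dependent, and column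
  indices and edges alike can serve as index type. Used for finite \<open>J\<close>.\<close>

definition indep_family :: "nat \<Rightarrow> ('b \<Rightarrow> nat \<Rightarrow> real) \<Rightarrow> 'b set \<Rightarrow> bool" where
  "indep_family n v J \<longleftrightarrow>
     (\<forall>a. (\<forall>u<n. (\<Sum>j\<in>J. a j * v j u) = 0) \<longrightarrow> (\<forall>j\<in>J. a j = 0))"

lemma indep_familyD:
  assumes "indep_family n v J" and "\<And>u. u < n \<Longrightarrow> (\<Sum>j\<in>J. a j * v j u) = 0" and "j \<in> J"
  shows "a j = 0"
  using assms unfolding indep_family_def by blast

lemma indep_family_subset:
  assumes "indep_family n v J" and "finite J" and "I \<subseteq> J"
  shows "indep_family n v I"
  unfolding indep_family_def
proof (intro allI impI ballI)
  fix a j assume a: "\<forall>u<n. (\<Sum>j\<in>I. a j * v j u) = 0" and j: "j \<in> I"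
  let ?b = "\<lambda>j. if j \<in> I then a j else 0"
  have "(\<Sum>j\<in>J. ?b j * v j u) = (\<Sum>j\<in>I. a j * v j u)" for u
    using assms(2,3) by (intro sum.mono_neutral_cong_right) auto
  then have "?b j = 0"
    using indep_familyD[OF assms(1), of ?b j] a j assms(3) by auto
  with j show "a j = 0" by simp
qed

lemma indep_family_cong:
  assumes "\<And>j u. j \<in> J \<Longrightarrow> u < n \<Longrightarrow> v j u = w j u"
  shows "indep_family n v J \<longleftrightarrow> indep_family n w J"
proof -
  have "(\<Sum>j\<in>J. a j * v j u) = (\<Sum>j\<in>J. a j * w j u)" if "u < n" for a u
    using assms that by (intro sum.cong) auto
  then show ?thesis by (simp add: indep_family_def)
qed

lemma indep_family_image:
  assumes "inj_on f J"
  shows "indep_family n v (f ` J) \<longleftrightarrow> indep_family n (v \<circ> f) J"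
proof
  assume L: "indep_family n v (f ` J)"
  show "indep_family n (v \<circ> f) J"
    unfolding indep_family_def
  proof (intro allI impI ballI)
    fix a j assume a: "\<forall>u<n. (\<Sum>j\<in>J. a j * (v \<circ> f) j u) = 0" and j: "j \<in> J"
    let ?b = "a \<circ> the_inv_into J f"
    have "(\<Sum>k\<in>f ` J. ?b k * v k u) = (\<Sum>j\<in>J. a j * (v \<circ> f) j u)" for u
      using assms by (subst sum.reindex) (auto simp: the_inv_into_f_f intro!: sum.cong)
    then have "?b (f j) = 0"
      using indep_familyD[OF L, of ?b "f j"] a j by auto
    then show "a j = 0" using assms j by (simp add: the_inv_into_f_f)
  qed
next
  assume R: "indep_family n (v \<circ> f) J"
  show "indep_family n v (f ` J)"
    unfolding indep_family_def
  proof (intro allI impI ballI)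
    fix a k assume a: "\<forall>u<n. (\<Sum>k\<in>f ` J. a k * v k u) = 0" and k: "k \<in> f ` J"
    then obtain j where j: "j \<in> J" "k = f j" by auto
    have "(\<Sum>j\<in>J. (a \<circ> f) j * (v \<circ> f) j u) = 0" if "u < n" for u
      using a that assms by (simp add: sum.reindex)
    then show "a k = 0" using indep_familyD[OF R, of "a \<circ> f" j] j by auto
  qed
qed

text \<open>Gaussian elimination, one equation at a time: if equation \<open>x\<close> is not
  trivial, an unknown \<open>p\<close> that occurs in it is eliminated from the other equations and
  finally gets the value that \<open>x\<close> dictates.\<close>

lemma nontrivial_solution:
  fixes m :: "'x \<Rightarrow> 'y \<Rightarrow> real"
  assumes "finite X" and "finite Y" and "card X < card Y"
  shows "\<exists>b. (\<exists>y\<in>Y. b y \<noteq> 0) \<and> (\<forall>x\<in>X. (\<Sum>y\<in>Y. b y * m x y) = 0)"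
  using assms
proof (induction X arbitrary: Y m rule: finite_induct)
  case empty
  then have "Y \<noteq> {}" by auto
  then show ?case by (intro exI[of _ "\<lambda>_. 1"]) auto
next
  case (insert x X)
  show ?case
  proof (cases "\<forall>y\<in>Y. m x y = 0")
    case True
    have "card X < card Y" using insert by simp
    from insert.IH[OF insert.prems(1) this, of m] True show ?thesis by auto
  next
    case False
    then obtain p where p: "p \<in> Y" "m x p \<noteq> 0" by auto
    let ?m = "\<lambda>z y. m z y - m z p * m x y / m x p"
    have "finite (Y - {p})" "card X < card (Y - {p})" using insert p by auto
    from insert.IH[OF this, of ?m] obtain b where
      b: "\<exists>y\<in>Y - {p}. b y \<noteq> 0" "\<And>z. z \<in> X \<Longrightarrow> (\<Sum>y\<in>Y - {p}. b y * ?m z y) = 0" by auto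
    define s where "s = (\<Sum>y\<in>Y - {p}. b y * m x y)"
    let ?b = "b(p := - s / m x p)"
    have split: "(\<Sum>y\<in>Y. ?b y * m z y) = (\<Sum>y\<in>Y - {p}. b y * m z y) - s / m x p * m z p" for z
      using insert.prems p by (subst sum.remove[of Y p]) auto
    have *: "(\<Sum>y\<in>Y. ?b y * m z y) = 0" if "z \<in> insert x X" for z
    proof (cases "z = x")
      case True
      show ?thesis unfolding True split using p(2) by (simp add: s_def)
    next
      case False
      have "0 = (\<Sum>y\<in>Y - {p}. b y * ?m z y)" using b(2) that False by auto
      also have "\<dots> = (\<Sum>y\<in>Y - {p}. b y * m z y) - (\<Sum>y\<in>Y - {p}. m z p / m x p * (b y * m x y))"
        by (simp add: algebra_simps sum_subtractf)
      also have "(\<Sum>y\<in>Y - {p}. m z p / m x p * (b y * m x y)) = s / m x p * m z p"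
        unfolding s_def sum_distrib_left[symmetric] by simp
      finally show ?thesis unfolding split by simp
    qed
    have "\<exists>y\<in>Y. ?b y \<noteq> 0" using b(1) by auto
    with * show ?thesis by (intro exI[of _ ?b] conjI ballI)
  qed
qed

text \<open>The coordinates are equations for the coefficients of a relation, so more than
  \<open>n\<close> vectors admit a nontrivial one.\<close>

lemma card_indep_family_le:
  assumes "indep_family n v J" and "finite J"
  shows "card J \<le> n"
proof (rule ccontr)
  assume "\<not> card J \<le> n"
  then have "card {..<n} < card J" by simp
  from nontrivial_solution[OF finite_lessThan assms(2) this, of "\<lambda>u j. v j u"] obtain b j where
    b: "j \<in> J" "b j \<noteq> 0" "\<And>u. u < n \<Longrightarrow> (\<Sum>j\<in>J. b j * v j u) = 0" by blast
  then show False using indep_familyD[OF assms(1) b(3) b(1)] by blast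
qed

text \<open>In a nontrivial relation on \<open>insert y X\<close> the coefficient of
  \<open>y\<close> cannot vanish, since otherwise \<open>X\<close> would carry the relation;
  dividing by it expresses \<open>v y\<close>.\<close>

lemma indep_family_dependent_insert:
  assumes X: "indep_family n v X" "finite X" and y: "y \<notin> X" "\<not> indep_family n v (insert y X)"
  shows "\<exists>m. \<forall>u<n. v y u = (\<Sum>x\<in>X. m x * v x u)"
proof -
  obtain a j where a: "\<And>u. u < n \<Longrightarrow> (\<Sum>j\<in>insert y X. a j * v j u) = 0"
    and j: "j \<in> insert y X" "a j \<noteq> 0"
    using y(2) unfolding indep_family_def by blast
  have eq: "a y * v y u + (\<Sum>x\<in>X. a x * v x u) = 0" if "u < n" for u
    using a[OF that] X(2) y(1) by simp
  have ay: "a y \<noteq> 0"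
  proof
    assume 0: "a y = 0"
    then have "a x = 0" if "x \<in> X" for x
      using indep_familyD[OF X(1), of a x] eq that by auto
    with 0 j show False by auto
  qed
  have "v y u = (\<Sum>x\<in>X. (- a x / a y) * v x u)" if "u < n" for u
  proof -
    have "(\<Sum>x\<in>X. (- a x / a y) * v x u) = - (\<Sum>x\<in>X. a x * v x u) / a y"
      by (simp add: sum_divide_distrib sum_negf)
    also have "\<dots> = v y u" using eq[OF that] ay by (simp add: field_simps)
    finally show ?thesis by simp
  qed
  then show ?thesis by (intro exI[of _ "\<lambda>x. - a x / a y"]) blast
qed

text \<open>If nothing extends \<open>X\<close>, every vector of \<open>Y\<close> is a combination
  of those of \<open>X\<close>. The coefficients form a system with fewer equations than unknowns,
  and a nontrivial solution is a relation on \<open>Y\<close>.\<close>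

lemma indep_family_augment:
  assumes X: "indep_family n v X" "finite X" and Y: "indep_family n v Y" "finite Y"
    and lt: "card X < card Y"
  shows "\<exists>y\<in>Y - X. indep_family n v (insert y X)"
proof (rule ccontr)
  assume neg: "\<not> ?thesis"
  have "\<exists>m. \<forall>u<n. v y u = (\<Sum>x\<in>X. m x * v x u)" if "y \<in> Y" for y
  proof (cases "y \<in> X")
    case True
    have "(\<Sum>x\<in>X. (if x = y then 1 else 0) * v x u) = (\<Sum>x\<in>X. if x = y then v x u else 0)" for u
      by (intro sum.cong) auto
    then show ?thesis using True X(2)
      by (intro exI[of _ "\<lambda>x. if x = y then 1 else 0"]) simp
  next
    case False
    then show ?thesis using indep_family_dependent_insert[OF X, of y] neg that by blast
  qed
  then have "\<forall>y\<in>Y. \<exists>m. \<forall>u<n. v y u = (\<Sum>x\<in>X. m x * v x u)" by blast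
  from bchoice[OF this] obtain m where
    m: "\<And>y u. y \<in> Y \<Longrightarrow> u < n \<Longrightarrow> v y u = (\<Sum>x\<in>X. m y x * v x u)" by blast
  from nontrivial_solution[OF X(2) Y(2) lt, of "\<lambda>x y. m y x"] obtain b y where
    y: "y \<in> Y" "b y \<noteq> 0" and b: "\<And>x. x \<in> X \<Longrightarrow> (\<Sum>y\<in>Y. b y * m y x) = 0"
    by blast
  have "(\<Sum>y\<in>Y. b y * v y u) = 0" if "u < n" for u
  proof -
    have "(\<Sum>y\<in>Y. b y * v y u) = (\<Sum>y\<in>Y. \<Sum>x\<in>X. b y * m y x * v x u)"
      using m that by (simp add: sum_distrib_left mult.assoc)
    also have "\<dots> = (\<Sum>x\<in>X. (\<Sum>y\<in>Y. b y * m y x) * v x u)"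
      by (subst sum.swap) (simp add: sum_distrib_right)
    also have "\<dots> = 0" using b by simp
    finally show ?thesis .
  qed
  from indep_familyD[OF Y(1) this y(1)] y(2) show False by blast
qed

section \<open>Vector matroids of real matrices\<close>

lemma indep_family_col_iff:
  fixes A :: "real mat"
  assumes J: "J \<subseteq> {..<dim_col A}"
  shows "(inj_on (col A) J \<and>
      \<not> LinearCombinations.module.lin_dep class_ring (module_vec TYPE(real) (dim_row A)) (col A ` J))
    \<longleftrightarrow> indep_family (dim_row A) (\<lambda>j u. A $$ (u, j)) J" (is "?L \<longleftrightarrow> ?R")
proof -
  interpret V: vec_space "TYPE(real)" "dim_row A" .
  have fin: "finite J" using J finite_subset by blast
  have carr: "col A ` J \<subseteq> carrier_vec (dim_row A)" by auto
  have colidx: "col A j $ u = A $$ (u, j)" if "j \<in> J" "u < dim_row A" for j u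
    using that J by auto
  show ?thesis
  proof
    assume ?L
    then have inj: "inj_on (col A) J" and li: "\<not> V.lin_dep (col A ` J)" by auto
    show ?R unfolding indep_family_def
    proof (intro allI impI ballI)
      fix a j assume a: "\<forall>u<dim_row A. (\<Sum>j\<in>J. a j * A $$ (u, j)) = 0" and j: "j \<in> J"
      \<comment> \<open>Injectivity of \<open>col A\<close> turns coefficients of indices into
        coefficients of column vectors.\<close>
      let ?b = "a \<circ> the_inv_into J (col A)"
      have "V.lincomb ?b (col A ` J) = 0\<^sub>v (dim_row A)"
      proof (rule eq_vecI)
        show "dim_vec (V.lincomb ?b (col A ` J)) = dim_vec (0\<^sub>v (dim_row A))"
          using V.lincomb_dim[OF _ carr] fin by simp
        fix u assume u: "u < dim_vec (0\<^sub>v (dim_row A))"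
        then have "V.lincomb ?b (col A ` J) $ u = (\<Sum>x\<in>col A ` J. ?b x * x $ u)"
          by (intro V.lincomb_index[OF _ carr]) simp
        also have "\<dots> = (\<Sum>j\<in>J. a j * A $$ (u, j))"
          using inj u by (subst sum.reindex) (auto simp: the_inv_into_f_f colidx intro!: sum.cong)
        finally show "V.lincomb ?b (col A ` J) $ u = 0\<^sub>v (dim_row A) $ u" using a u by simp
      qed
      then have "?b \<in> col A ` J \<rightarrow> {0}"
        using V.not_lindepD[OF li, of "col A ` J" ?b] fin by auto
      then have "?b (col A j) = 0" using j by blast
      then show "a j = 0" using inj j by (simp add: the_inv_into_f_f)
    qed
  next
    assume R: ?R
    have inj: "inj_on (col A) J"
    proof (rule inj_onI, rule ccontr)
      fix j k assume jk: "j \<in> J" "k \<in> J" "col A j = col A k" "j \<noteq> k"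
      have eq: "A $$ (u, j) = A $$ (u, k)" if "u < dim_row A" for u
        using jk colidx[OF jk(1) that] colidx[OF jk(2) that] by simp
      \<comment> \<open>Two equal columns satisfy the relation with coefficients 1 and -1.\<close>
      let ?a = "\<lambda>i. if i = j then 1 else if i = k then - 1 else 0"
      have "(\<Sum>i\<in>J. ?a i * A $$ (u, i)) = 0" if "u < dim_row A" for u
      proof -
        have "(\<Sum>i\<in>J. ?a i * A $$ (u, i)) = (\<Sum>i\<in>{j, k}. ?a i * A $$ (u, i))"
          using fin jk by (intro sum.mono_neutral_right) auto
        also have "\<dots> = 0" using jk(4) eq[OF that] by simp
        finally show ?thesis .
      qed
      then show False using indep_familyD[OF R, of ?a j] jk(1) by simp
    qed
    moreover have "V.lin_indpt (col A ` J)"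
    proof (rule V.finite_lin_indpt2)
      show "finite (col A ` J)" using fin by simp
      show "col A ` J \<subseteq> carrier_vec (dim_row A)" by (rule carr)
      fix b :: "real vec \<Rightarrow> real"
      assume b: "V.lincomb b (col A ` J) = 0\<^sub>v (dim_row A)"
      have "(\<Sum>j\<in>J. (b \<circ> col A) j * A $$ (u, j)) = 0" if u: "u < dim_row A" for u
      proof -
        have "(\<Sum>j\<in>J. (b \<circ> col A) j * A $$ (u, j)) = (\<Sum>x\<in>col A ` J. b x * x $ u)"
          using inj u by (subst sum.reindex) (auto simp: colidx intro!: sum.cong)
        also have "\<dots> = V.lincomb b (col A ` J) $ u"
          using V.lincomb_index[OF u carr] by simp
        finally show ?thesis using b u by simp
      qed
      from indep_familyD[OF R this] show "\<forall>v\<in>col A ` J. b v = 0" by auto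
    qed
    ultimately show ?L by simp
  qed
qed

lemma indep_vector_matroid_iff:
  "J \<in> indeps (vector_matroid A) \<longleftrightarrow>
     J \<subseteq> {..<dim_col A} \<and> indep_family (dim_row A) (\<lambda>j u. A $$ (u, j)) J"
  using indep_family_col_iff[of J A] by (auto simp: vector_matroid_def)

lemma ground_vector_matroid [simp]: "ground (vector_matroid A) = {..<dim_col A}"
  by (simp add: vector_matroid_def)

lemma matroid_vector_matroid: "matroid (vector_matroid A)"
proof
  let ?v = "\<lambda>j u. A $$ (u, j)"
  show "finite (ground (vector_matroid A))" by simp
  show "indeps (vector_matroid A) \<subseteq> Pow (ground (vector_matroid A))"
    by (auto simp: indep_vector_matroid_iff)
  show "{} \<in> indeps (vector_matroid A)"
    by (auto simp: indep_vector_matroid_iff indep_family_def)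
  show "Y \<in> indeps (vector_matroid A)" if "X \<in> indeps (vector_matroid A)" "Y \<subseteq> X" for X Y
    using that indep_family_subset[of "dim_row A" ?v X Y] finite_subset[of X "{..<dim_col A}"]
    by (auto simp: indep_vector_matroid_iff)
  show "\<exists>y\<in>Y - X. insert y X \<in> indeps (vector_matroid A)"
    if "X \<in> indeps (vector_matroid A)" "Y \<in> indeps (vector_matroid A)" "card X < card Y" for X Y
  proof -
    have sub: "X \<subseteq> {..<dim_col A}" "Y \<subseteq> {..<dim_col A}"
      and ind: "indep_family (dim_row A) ?v X" "indep_family (dim_row A) ?v Y"
      using that by (auto simp: indep_vector_matroid_iff)
    have "finite X" "finite Y" using sub finite_subset by blast+
    then obtain y where "y \<in> Y - X" "indep_family (dim_row A) ?v (insert y X)"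
      using indep_family_augment[OF ind(1) _ ind(2) _ \<open>card X < card Y\<close>] by blast
    then show ?thesis using sub by (auto simp: indep_vector_matroid_iff)
  qed
qed

lemma matroid_rank_vector_matroid:
  assumes "J \<in> indeps (vector_matroid A)" and "card J = dim_row A"
  shows "matroid_rank (vector_matroid A) = dim_row A"
  unfolding matroid_rank_def
proof (rule Max_eqI)
  have "indeps (vector_matroid A) \<subseteq> Pow {..<dim_col A}" by (auto simp: indep_vector_matroid_iff)
  then show "finite (card ` indeps (vector_matroid A))" using finite_subset by blast
  show "k \<le> dim_row A" if "k \<in> card ` indeps (vector_matroid A)" for k
  proof -
    from that obtain X where "k = card X" "X \<subseteq> {..<dim_col A}"
      "indep_family (dim_row A) (\<lambda>j u. A $$ (u, j)) X"
      by (auto simp: indep_vector_matroid_iff)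
    then show ?thesis using card_indep_family_le finite_subset by blast
  qed
  show "dim_row A \<in> card ` indeps (vector_matroid A)" using assms by force
qed

text \<open>Serves to evaluate \<open>mat_rank\<close> in \<open>modular_mat\<close>. The
  independent columns give the lower bound; for the upper one, a maximal independent set of columns
  realises the rank and lives in dimension \<open>dim_row A\<close>.\<close>

lemma rank_vector_matroid:
  assumes "J \<in> indeps (vector_matroid A)" and "card J = dim_row A"
  shows "vec_space.rank (dim_row A) A = dim_row A"
proof -
  interpret V: vec_space "TYPE(real)" "dim_row A" .
  have J: "J \<subseteq> {..<dim_col A}" "inj_on (col A) J" "V.lin_indpt (col A ` J)"
    using assms(1) by (auto simp: vector_matroid_def)
  have A: "A \<in> carrier_mat (dim_row A) (dim_col A)" by simp
  have "col A ` J \<subseteq> set (cols A)" using J(1) by (auto simp: cols_def)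
  then have "card (col A ` J) \<le> V.rank A" using V.rank_ge_card_indpt[OF A] J(3) by blast
  then have "dim_row A \<le> V.rank A" using card_image[OF J(2)] assms(2) by simp
  moreover have "V.rank A \<le> dim_row A"
  proof -
    obtain S where S: "maximal S (\<lambda>T. T \<subseteq> set (cols A) \<and> V.lin_indpt T)"
      using maximal_exists_superset[of "set (cols A)" "\<lambda>T. T \<subseteq> set (cols A) \<and> V.lin_indpt T" "col A ` J"]
        \<open>col A ` J \<subseteq> set (cols A)\<close> J(3) by auto
    then have "S \<subseteq> set (cols A)" "V.lin_indpt S" by (auto simp: maximal_def)
    moreover have "S \<subseteq> carrier_vec (dim_row A)"
      using \<open>S \<subseteq> set (cols A)\<close> cols_dim[of A] by (rule subset_trans)
    ultimately have "card S \<le> V.dim" using V.li_le_dim(2)[OF V.fin_dim, of S] by simp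
    then show ?thesis using V.rank_card_indpt[OF A S] V.dim_is_n by simp
  qed
  ultimately show ?thesis by simp
qed

lemma simple_matroidI:
  assumes "\<And>X. X \<subseteq> ground M \<Longrightarrow> finite X \<Longrightarrow> card X \<le> 2 \<Longrightarrow> X \<in> indeps M"
  shows "simple_matroid M"
proof -
  have "{e, f} \<in> indeps M" if "{e, f} \<subseteq> ground M" for e f
    using assms[of "{e, f}"] that by (simp add: card_insert_if)
  then have "\<not> circuit M {e, f}" for e f by (auto simp: circuit_def)
  \<comment> \<open>The case \<open>f = e\<close> excludes loops.\<close>
  from this this[of e e for e] show ?thesis by (simp add: simple_matroid_def)
qed

section \<open>Determinants of gain matrices\<close>

text \<open>Network matrices are totally unimodular: a column has at most two nonzero entries, and
  two are opposite. If all columns sum to 0, the determinant vanishes; otherwise some column has a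
  single nonzero entry, and expansion along it reduces the size.\<close>

lemma abs_det_network_le_1:
  fixes B :: "int mat"
  assumes "B \<in> carrier_mat n n"
    and "\<And>u k. u < n \<Longrightarrow> k < n \<Longrightarrow> \<bar>B $$ (u, k)\<bar> \<le> 1"
    and "\<And>u u' k. u < n \<Longrightarrow> u' < n \<Longrightarrow> k < n \<Longrightarrow> u \<noteq> u' \<Longrightarrow>
      B $$ (u, k) \<noteq> 0 \<Longrightarrow> B $$ (u', k) \<noteq> 0 \<Longrightarrow> B $$ (u, k) + B $$ (u', k) = 0"
  shows "\<bar>det B\<bar> \<le> 1"
  using assms
proof (induction n arbitrary: B)
  case 0
  then show ?case by (simp add: det_dim_zero)
next
  case (Suc n)
  note B = Suc.prems(1)
  show ?case
  proof (cases "\<forall>k<Suc n. (\<Sum>u<Suc n. B $$ (u, k)) = 0")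
    case True
    let ?one = "vec (Suc n) (\<lambda>_. 1 :: int)"
    \<comment> \<open>The rows of \<open>B\<close> add up to zero.\<close>
    have "transpose_mat B *\<^sub>v ?one = 0\<^sub>v (Suc n)"
    proof (rule eq_vecI)
      fix k assume "k < dim_vec (0\<^sub>v (Suc n) :: int vec)"
      then have k: "k < Suc n" by simp
      then have "(transpose_mat B *\<^sub>v ?one) $ k = (\<Sum>u<Suc n. B $$ (u, k))"
        using B by (simp add: scalar_prod_def lessThan_atLeast0)
      then show "(transpose_mat B *\<^sub>v ?one) $ k = 0\<^sub>v (Suc n) $ k" using True k by simp
    qed (use B in simp)
    moreover have "?one \<noteq> 0\<^sub>v (Suc n)"
    proof
      assume "?one = 0\<^sub>v (Suc n)"
      then have "?one $ 0 = 0\<^sub>v (Suc n) $ 0" by simp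
      then show False by simp
    qed
    moreover have "?one \<in> carrier_vec (Suc n)" by simp
    ultimately have "det (transpose_mat B) = 0"
      using det_0_iff_vec_prod_zero[of "transpose_mat B" "Suc n"] B transpose_carrier_mat by blast
    then show ?thesis using det_transpose[OF B] by simp
  next
    case False
    then obtain k where k: "k < Suc n" "(\<Sum>u<Suc n. B $$ (u, k)) \<noteq> 0" by auto
    then obtain w where w: "w < Suc n" "B $$ (w, k) \<noteq> 0"
      using sum.neutral[of "{..<Suc n}" "\<lambda>u. B $$ (u, k)"] by blast
    have only: "B $$ (u, k) = 0" if u: "u < Suc n" "u \<noteq> w" for u
    proof (rule ccontr)
      assume nz: "B $$ (u, k) \<noteq> 0"
      have uw: "B $$ (u, k) + B $$ (w, k) = 0" using Suc.prems(3)[OF u(1) w(1) k(1) u(2) nz w(2)] .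
      \<comment> \<open>A third nonzero entry would be the negative of both the entries at
        \<open>u\<close> and \<open>w\<close>, which are themselves opposite.\<close>
      have "B $$ (x, k) = 0" if "x < Suc n" "x \<noteq> u" "x \<noteq> w" for x
        using Suc.prems(3)[OF that(1) u(1) k(1) that(2) _ nz]
          Suc.prems(3)[OF that(1) w(1) k(1) that(3) _ w(2)] uw w(2) by linarith
      then have "(\<Sum>x<Suc n. B $$ (x, k)) = (\<Sum>x\<in>{u, w}. B $$ (x, k))"
        using u(1) w(1) by (intro sum.mono_neutral_right) auto
      then show False using uw u(2) k(2) by simp
    qed
    have "det B = (\<Sum>u<Suc n. B $$ (u, k) * cofactor B u k)"
      using laplace_expansion_column[OF B k(1)] .
    also have "\<dots> = (\<Sum>u\<in>{w}. B $$ (u, k) * cofactor B u k)"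
      using only w(1) by (intro sum.mono_neutral_right) auto
    finally have "\<bar>det B\<bar> = \<bar>B $$ (w, k)\<bar> * \<bar>det (mat_delete B w k)\<bar>"
      by (simp add: cofactor_def abs_mult power_abs)
    also have "\<dots> \<le> 1 * 1"
    proof (rule mult_mono)
      have entry: "mat_delete B w k $$ (u, l) = B $$ (insert_index w u, insert_index k l)"
        if "u < n" "l < n" for u l
        using mat_delete_index[OF B w(1) k(1) that] by simp
      have lt: "insert_index w u < Suc n" if "u < n" for w u
        using that by (simp add: insert_index_def)
      have ne: "insert_index w u \<noteq> insert_index w u'" if "u \<noteq> u'" for u u'
        using that by (auto simp: insert_index_def)
      show "\<bar>det (mat_delete B w k)\<bar> \<le> 1"
      proof (rule Suc.IH)
        show "mat_delete B w k \<in> carrier_mat n n" using mat_delete_carrier[OF B] by simp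
        show "\<bar>mat_delete B w k $$ (u, l)\<bar> \<le> 1" if "u < n" "l < n" for u l
          unfolding entry[OF that] by (intro Suc.prems(2) lt that)
        show "mat_delete B w k $$ (u, l) + mat_delete B w k $$ (u', l) = 0"
          if "u < n" "u' < n" "l < n" "u \<noteq> u'" "mat_delete B w k $$ (u, l) \<noteq> 0"
            "mat_delete B w k $$ (u', l) \<noteq> 0" for u u' l
          using that(5,6) unfolding entry[OF that(1,3)] entry[OF that(2,3)]
          by (intro Suc.prems(3) lt that ne)
      qed
    qed (use Suc.prems(2)[OF w(1) k(1)] in auto)
    finally show ?thesis by simp
  qed
qed

text \<open>
  The triple \<open>(i, j, g)\<close> stands for an edge of gain \<open>g\<close> from vertex \<open>i\<close> to vertex \<open>j\<close>. Coordinate 0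
  carries the gain, and vertex 0 has no coordinate of its own.
\<close>

fun gain_vec :: "nat \<times> nat \<times> int \<Rightarrow> nat \<Rightarrow> int" where
  "gain_vec (i, j, g) u = (if u = 0 then g else of_bool (u = i) - of_bool (u = j))"

text \<open>
  Subtracting the gain row from row \<open>v\<close> splits the vertex \<open>v\<close> into two vertices and turns the matrix
  into the incidence matrix of an ordinary directed graph.
\<close>

lemma abs_det_unit_gain_le_1:
  assumes v: "0 < v" "v < n"
    and g: "\<And>k. k < n \<Longrightarrow> - of_bool (j k = v) \<le> g k" "\<And>k. k < n \<Longrightarrow> g k \<le> of_bool (i k = v)"
  shows "\<bar>det (mat n n (\<lambda>(u, k). gain_vec (i k, j k, g k) u))\<bar> \<le> 1"
proof -
  let ?B = "mat n n (\<lambda>(u, k). gain_vec (i k, j k, g k) u)"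
  let ?C = "addrow (-1) v 0 ?B"
  have entry: "?C $$ (u, k) = (if u = 0 then g k
      else of_bool (u = i k) - of_bool (u = j k) - (if u = v then g k else 0))"
    if "u < n" "k < n" for u k
    using that v by auto
  have endpoints: "\<exists>p q. \<forall>u<n. ?C $$ (u, k) = of_bool (u = p) - of_bool (u = q)" if k: "k < n" for k
  proof -
    \<comment> \<open>Row 0 now belongs to the second copy of \<open>v\<close>. An endpoint 0 has no
      row and is replaced by \<open>n\<close>, which lies outside the matrix.\<close>
    let ?p = "if i k = 0 then n else i k" and ?q = "if j k = 0 then n else j k"
    have "-1 \<le> g k" "g k \<le> 1" using g[OF k] by (auto simp: of_bool_def split: if_splits)
    then have "g k = 0 \<or> g k = 1 \<or> g k = -1" by presburger
    \<comment> \<open>Edges of gain 1 start at the copy of \<open>v\<close>, edges of gain -1 end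
      there, and edges of gain 0 keep both endpoints.\<close>
    then consider "g k = 0" | "g k = 1" "i k = v" | "g k = -1" "j k = v"
      using g[OF k] by (auto simp: of_bool_def split: if_splits)
    then show ?thesis
    proof cases
      case 1
      have "?C $$ (u, k) = of_bool (u = ?p) - of_bool (u = ?q)" if "u < n" for u
        unfolding entry[OF that k] using 1 v that by auto
      then show ?thesis by blast
    next
      case 2
      have "?C $$ (u, k) = of_bool (u = 0) - of_bool (u = ?q)" if "u < n" for u
        unfolding entry[OF that k] using 2 v that by auto
      then show ?thesis by blast
    next
      case 3
      have "?C $$ (u, k) = of_bool (u = ?p) - of_bool (u = 0)" if "u < n" for u
        unfolding entry[OF that k] using 3 v that by auto
      then show ?thesis by blast
    qed
  qed
  have "\<bar>det ?C\<bar> \<le> 1"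
  proof (rule abs_det_network_le_1)
    show "?C \<in> carrier_mat n n" by simp
    show "\<bar>?C $$ (u, k)\<bar> \<le> 1" if u: "u < n" and k: "k < n" for u k
    proof -
      obtain p q where eq: "?C $$ (u, k) = of_bool (u = p) - of_bool (u = q)"
        using endpoints[OF k] u by blast
      show ?thesis unfolding eq by (simp add: of_bool_def)
    qed
    show "?C $$ (u, k) + ?C $$ (u', k) = 0"
      if u: "u < n" "u' < n" and k: "k < n" and ne: "u \<noteq> u'" "?C $$ (u, k) \<noteq> 0" "?C $$ (u', k) \<noteq> 0"
      for u u' k
    proof -
      obtain p q where eq: "?C $$ (u, k) = of_bool (u = p) - of_bool (u = q)"
        "?C $$ (u', k) = of_bool (u' = p) - of_bool (u' = q)"
        using endpoints[OF k] u by blast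
      show ?thesis using ne unfolding eq by (auto simp: of_bool_def split: if_splits)
    qed
  qed
  also have "det ?C = det ?B" using v by (intro det_addrow[where n = n]) auto
  finally show ?thesis .
qed

text \<open>The determinant is linear in the gain row. Replacing every gain by its extreme value in
  the direction of the flow bounds it by the determinants for unit gains at the vertices
  \<open>v\<close>, taken \<open>c v\<close> times, and each of those is at most 1.\<close>

lemma abs_det_gain_le:
  fixes c :: "nat \<Rightarrow> nat"
  assumes n: "0 < n" and c0: "c 0 = 0"
    and ij: "\<And>k. k < n \<Longrightarrow> i k < n" "\<And>k. k < n \<Longrightarrow> j k < n"
    and g: "\<And>k. k < n \<Longrightarrow> - int (c (j k)) \<le> g k" "\<And>k. k < n \<Longrightarrow> g k \<le> int (c (i k))"
  shows "\<bar>det (mat n n (\<lambda>(u, k). gain_vec (i k, j k, g k) u))\<bar> \<le> int (\<Sum>v<n. c v)"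
proof -
  let ?B = "\<lambda>g. mat n n (\<lambda>(u, k). gain_vec (i k, j k, g k) u)"
  define w where "w k = cofactor (?B g) 0 k" for k
  have det_eq: "det (?B h) = (\<Sum>k<n. h k * w k)" for h
  proof -
    \<comment> \<open>Deleting row 0 removes all gains, so the cofactors are the same for every
      \<open>h\<close>.\<close>
    have "cofactor (?B h) 0 k = w k" if "k < n" for k
    proof -
      have "mat_delete (?B h) 0 k = mat_delete (?B g) 0 k"
        using that by (intro eq_matI) (auto simp: mat_delete_def)
      then show ?thesis by (simp add: w_def cofactor_def)
    qed
    then show ?thesis
      using laplace_expansion_row[of "?B h" n 0] n by simp
  qed
  text \<open>The \<open>w k\<close> form a circulation; \<open>h v\<close> are unit gains on the edges that it uses to leave \<open>v\<close>.\<close>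
  have *: "s * det (?B g) \<le> int (\<Sum>v<n. c v)" if s: "s = 1 \<or> s = -1" for s :: int
  proof -
    define h where "h v k = (if s * w k > 0 then of_bool (i k = v) else - of_bool (j k = v) :: int)" for v k
    \<comment> \<open>The endpoint at which the flow \<open>s * w\<close> enters edge
      \<open>k\<close>: the edge is traversed backwards if the flow is negative.\<close>
    define tl where "tl k = (if s * w k > 0 then i k else j k)" for k
    have "s * det (?B g) = (\<Sum>k<n. s * w k * g k)"
      unfolding det_eq sum_distrib_left by (simp add: mult_ac)
    \<comment> \<open>The upper bound on the gain applies where the flow is positive, the lower
      bound elsewhere; both give the weight of \<open>tl k\<close> times the absolute value of the
      flow.\<close>
    also have "\<dots> \<le> (\<Sum>k<n. \<Sum>v<n. int (c v) * (s * w k * h v k))"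
    proof (rule sum_mono)
      fix k assume "k \<in> {..<n}"
      then have k: "k < n" by simp
      then have "tl k < n" using ij by (simp add: tl_def)
      have "s * w k * h v k = (if tl k = v then \<bar>s * w k\<bar> else 0)" for v
        by (simp add: h_def tl_def)
      then have "(\<Sum>v<n. int (c v) * (s * w k * h v k))
          = (\<Sum>v<n. if tl k = v then int (c v) * \<bar>s * w k\<bar> else 0)"
        by (intro sum.cong) auto
      also have "\<dots> = int (c (tl k)) * \<bar>s * w k\<bar>" using \<open>tl k < n\<close> by simp
      finally have eq: "(\<Sum>v<n. int (c v) * (s * w k * h v k)) = int (c (tl k)) * \<bar>s * w k\<bar>" .
      show "s * w k * g k \<le> (\<Sum>v<n. int (c v) * (s * w k * h v k))"
      proof (cases "s * w k > 0")
        case True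
        then have "s * w k * g k \<le> s * w k * int (c (i k))"
          using g(2)[OF k] by (intro mult_left_mono) auto
        then show ?thesis unfolding eq using True by (simp add: tl_def mult.commute)
      next
        case False
        then have "s * w k * g k \<le> s * w k * (- int (c (j k)))"
          using g(1)[OF k] by (intro mult_left_mono_neg) auto
        then show ?thesis unfolding eq using False by (simp add: tl_def mult.commute)
      qed
    qed
    also have "\<dots> = (\<Sum>v<n. int (c v) * (s * det (?B (h v))))"
      unfolding det_eq sum_distrib_left by (subst sum.swap) (simp add: mult_ac)
    also have "\<dots> \<le> (\<Sum>v<n. int (c v) * 1)"
    proof (rule sum_mono)
      fix v assume v: "v \<in> {..<n}"
      show "int (c v) * (s * det (?B (h v))) \<le> int (c v) * 1"
      \<comment> \<open>Vertex 0 has no row that could be split, but its weight is 0, so it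
        contributes nothing.\<close>
      proof (cases "v = 0")
        case True
        then show ?thesis using c0 by simp
      next
        case False
        have "\<bar>det (?B (h v))\<bar> \<le> 1"
          using v False by (intro abs_det_unit_gain_le_1[of v]) (auto simp: h_def)
        then have "s * det (?B (h v)) \<le> 1" using s by auto
        then show ?thesis by (intro mult_left_mono) auto
      qed
    qed
    finally show ?thesis by simp
  qed
  from *[of 1] *[of "-1"] show ?thesis by simp
qed

section \<open>Lines of gain matroids\<close>

text \<open>In a matroid these are the sets of rank at most 2.\<close>

definition collinear :: "'a indep_system \<Rightarrow> 'a set \<Rightarrow> bool" where
  "collinear M X \<longleftrightarrow> X \<subseteq> ground M \<and> (\<forall>T\<subseteq>X. card T = 3 \<longrightarrow> T \<notin> indeps M)"

text \<open>The lines with \<open>s\<close> points, if the matroid has rank at least 2. Their number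
  is the isomorphism invariant that separates the matroids.\<close>

definition max_collinear :: "'a indep_system \<Rightarrow> nat \<Rightarrow> 'a set set" where
  "max_collinear M s = {X. card X = s \<and> collinear M X \<and> (\<forall>Y. collinear M Y \<longrightarrow> X \<subseteq> Y \<longrightarrow> Y = X)}"

lemma card_max_collinear_iso:
  assumes "matroid_iso M N"
  shows "card (max_collinear M s) = card (max_collinear N s)"
proof -
  obtain f where bij: "bij_betw f (ground M) (ground N)"
    and ind: "\<And>X. X \<subseteq> ground M \<Longrightarrow> X \<in> indeps M \<longleftrightarrow> f ` X \<in> indeps N"
    using assms unfolding matroid_iso_def by blast
  have inj: "inj_on f (ground M)" and im: "f ` ground M = ground N"
    using bij by (auto simp: bij_betw_def)
  have card_im: "card (f ` X) = card X" if "X \<subseteq> ground M" for X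
    using card_image inj_on_subset[OF inj that] by blast
  have sub_im: "\<exists>X\<subseteq>ground M. Y = f ` X" if "Y \<subseteq> ground N" for Y
    using that im subset_image_iff[of Y f "ground M"] by blast
  have sub_iff: "f ` X \<subseteq> f ` Y \<longleftrightarrow> X \<subseteq> Y" if "X \<subseteq> ground M" "Y \<subseteq> ground M" for X Y
    using inj_on_image_mem_iff[OF inj] that by blast
  have col: "collinear N (f ` X) \<longleftrightarrow> collinear M X" if X: "X \<subseteq> ground M" for X
  proof -
    have T: "card (f ` T) = card T" "T \<in> indeps M \<longleftrightarrow> f ` T \<in> indeps N" if "T \<subseteq> X" for T
      using card_im[of T] ind[of T] X that by auto
    have "(\<forall>T\<subseteq>f ` X. card T = 3 \<longrightarrow> T \<notin> indeps N) \<longleftrightarrow> (\<forall>T\<subseteq>X. card (f ` T) = 3 \<longrightarrow> f ` T \<notin> indeps N)"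
      by (auto simp: subset_image_iff)
    also have "\<dots> \<longleftrightarrow> (\<forall>T\<subseteq>X. card T = 3 \<longrightarrow> T \<notin> indeps M)"
      using T by (intro iffI allI impI) simp_all
    finally show ?thesis using X im by (auto simp: collinear_def)
  qed
  have eq_iff: "f ` X = f ` Y \<longleftrightarrow> X = Y" if "X \<subseteq> ground M" "Y \<subseteq> ground M" for X Y
    using inj_on_image_eq_iff[OF inj that] .
  have mem: "f ` X \<in> max_collinear N s \<longleftrightarrow> X \<in> max_collinear M s" if X: "X \<subseteq> ground M" for X
  proof -
    have "(\<forall>Y. collinear N Y \<longrightarrow> f ` X \<subseteq> Y \<longrightarrow> Y = f ` X)
        \<longleftrightarrow> (\<forall>Y\<subseteq>ground M. collinear N (f ` Y) \<longrightarrow> f ` X \<subseteq> f ` Y \<longrightarrow> f ` Y = f ` X)"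
      using sub_im unfolding collinear_def by metis
    also have "\<dots> \<longleftrightarrow> (\<forall>Y. collinear M Y \<longrightarrow> X \<subseteq> Y \<longrightarrow> Y = X)"
      using col sub_iff eq_iff X unfolding collinear_def by meson
    finally show ?thesis using X by (simp add: max_collinear_def card_im col)
  qed
  have "max_collinear N s = (\<lambda>X. f ` X) ` max_collinear M s"
  proof (intro equalityI subsetI)
    fix Y assume Y: "Y \<in> max_collinear N s"
    then have "Y \<subseteq> ground N" by (simp add: max_collinear_def collinear_def)
    with sub_im obtain X where "X \<subseteq> ground M" "Y = f ` X" by blast
    with mem Y show "Y \<in> (\<lambda>X. f ` X) ` max_collinear M s" by blast
  next
    fix Y assume "Y \<in> (\<lambda>X. f ` X) ` max_collinear M s"
    then obtain X where X: "X \<in> max_collinear M s" "Y = f ` X" by blast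
    then have "X \<subseteq> ground M" by (simp add: max_collinear_def collinear_def)
    with mem X show "Y \<in> max_collinear N s" by blast
  qed
  moreover have "inj_on (\<lambda>X. f ` X) (max_collinear M s)"
    by (rule inj_onI) (use eq_iff in \<open>auto simp: max_collinear_def collinear_def\<close>)
  ultimately show ?thesis by (simp add: card_image)
qed

section \<open>Elements of gain matroids and their ends\<close>

definition vertex_pairs :: "nat \<Rightarrow> (nat \<times> nat) set" where
  "vertex_pairs r = {(i, j). i < j \<and> j < r}"

fun parallel_edges :: "(nat \<Rightarrow> nat) \<Rightarrow> nat \<times> nat \<Rightarrow> (nat \<times> nat \<times> int) set" where
  "parallel_edges c (i, j) = {i} \<times> {j} \<times> {- int (c j)..int (c i)}"

text \<open>Encoded as a loop of gain 1 at vertex 0: the incidences cancel, and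
  \<open>gain_vec\<close> gives the unit vector of the gain coordinate.\<close>

abbreviation apex :: "nat \<times> nat \<times> int" where
  "apex \<equiv> (0, 0, 1)"

definition gain_elements :: "nat \<Rightarrow> (nat \<Rightarrow> nat) \<Rightarrow> (nat \<times> nat \<times> int) set" where
  "gain_elements r c = insert apex (\<Union>p\<in>vertex_pairs r. parallel_edges c p)"

text \<open>A copy of \<open>gain_vector_matroid\<close> on the edges themselves instead of column
  indices, in which the lines can be described.\<close>

definition gain_matroid :: "nat \<Rightarrow> (nat \<Rightarrow> nat) \<Rightarrow> (nat \<times> nat \<times> int) indep_system" where
  "gain_matroid r c = \<lparr>ground = gain_elements r c,
     indeps = {X. X \<subseteq> gain_elements r c \<and> indep_family r (\<lambda>t u. real_of_int (gain_vec t u)) X}\<rparr>"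

text \<open>A loop has no ends, because its tail and head cancel in the incidence vector.\<close>

fun ends :: "nat \<times> nat \<times> int \<Rightarrow> nat set" where
  "ends (i, j, g) = (if i = j then {} else {i, j})"

lemma gain_elements_iff:
  "(i, j, g) \<in> gain_elements r c \<longleftrightarrow>
     (i, j, g) = apex \<or> i < j \<and> j < r \<and> - int (c j) \<le> g \<and> g \<le> int (c i)"
  by (auto simp: gain_elements_def vertex_pairs_def)

lemma finite_vertex_pairs [simp]: "finite (vertex_pairs r)"
  by (rule finite_subset[of _ "{..<r} \<times> {..<r}"]) (auto simp: vertex_pairs_def)

lemma finite_parallel_edges [simp]: "finite (parallel_edges c p)"
  by (cases p) simp

lemma finite_gain_elements [simp]: "finite (gain_elements r c)"
  by (simp add: gain_elements_def)

lemma ends_empty_iff: "t \<in> gain_elements r c \<Longrightarrow> ends t = {} \<longleftrightarrow> t = apex"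
  by (cases t) (auto simp: gain_elements_iff)

lemma ends_subset: "t \<in> gain_elements r c \<Longrightarrow> ends t \<subseteq> {..<r}"
  by (cases t) (auto simp: gain_elements_iff split: if_splits)

lemma card_ends: "t \<in> gain_elements r c \<Longrightarrow> t \<noteq> apex \<Longrightarrow> card (ends t) = 2"
  by (cases t) (auto simp: gain_elements_iff)

lemma finite_ends [simp]: "finite (ends t)"
  by (cases t) auto

lemma ends_eqD:
  assumes "(i, j, g) \<in> gain_elements r c" and "(k, l, h) \<in> gain_elements r c"
    and "ends (i, j, g) = ends (k, l, h)"
  shows "i = k \<and> j = l"
  using assms by (auto simp: gain_elements_iff doubleton_eq_iff split: if_splits)

section \<open>Independence of small sets of edges\<close>

abbreviation gain_indep :: "nat \<Rightarrow> (nat \<times> nat \<times> int) set \<Rightarrow> bool" where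
  "gain_indep r \<equiv> indep_family r (\<lambda>t u. real_of_int (gain_vec t u))"

text \<open>
  Balance at vertex 0, which has no coordinate, holds because the vertex entries of an edge add up
  to zero.
\<close>

lemma gain_relation_balanced:
  fixes a :: "nat \<times> nat \<times> int \<Rightarrow> real"
  assumes X: "X \<subseteq> gain_elements r c" and r: "0 < r"
    and a: "\<And>u. u < r \<Longrightarrow> (\<Sum>t\<in>X. a t * real_of_int (gain_vec t u)) = 0" and u: "u < r"
  shows "(\<Sum>t\<in>X. a t * (of_bool (u = fst t) - of_bool (u = fst (snd t)))) = 0"
proof -
  let ?inc = "\<lambda>t u. of_bool (u = fst t) - of_bool (u = fst (snd t)) :: real"
  have pos: "(\<Sum>t\<in>X. a t * ?inc t u) = 0" if "0 < u" "u < r" for u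
  proof -
    have "?inc t u = real_of_int (gain_vec t u)" for t using that by (cases t) simp
    then show ?thesis using a[OF that(2)] by simp
  qed
  have zero: "(\<Sum>u<r. ?inc t u) = 0" if "t \<in> X" for t
  proof -
    obtain i j g where t: "t = (i, j, g)" by (cases t)
    have "i < r" "j < r" using subsetD[OF X that] r unfolding t by (auto simp: gain_elements_iff)
    then show ?thesis by (simp add: t sum_subtractf of_bool_def)
  qed
  have "0 = (\<Sum>t\<in>X. a t * (\<Sum>u<r. ?inc t u))" using zero by simp
  also have "\<dots> = (\<Sum>u<r. \<Sum>t\<in>X. a t * ?inc t u)"
    unfolding sum_distrib_left by (rule sum.swap)
  also have "\<dots> = (\<Sum>u\<in>{0}. \<Sum>t\<in>X. a t * ?inc t u)"
    using r pos by (intro sum.mono_neutral_right) auto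
  finally have "(\<Sum>t\<in>X. a t * ?inc t 0) = 0" by simp
  then show ?thesis using pos u by (cases "u = 0") auto
qed

text \<open>At \<open>u\<close> only \<open>t\<close> contributes to the balance of a relation. So
  the coefficient of \<open>t\<close> vanishes, and the relation lives on
  \<open>X - {t}\<close>.\<close>

lemma gain_indep_leaf:
  assumes X: "X \<subseteq> gain_elements r c" and t: "t \<in> X"
    and u: "u \<in> ends t" and others: "\<And>s. s \<in> X - {t} \<Longrightarrow> u \<notin> ends s"
    and ind: "gain_indep r (X - {t})"
  shows "gain_indep r X"
  unfolding indep_family_def
proof (intro allI impI ballI)
  fix a s assume a: "\<forall>u<r. (\<Sum>t\<in>X. a t * real_of_int (gain_vec t u)) = 0" and s: "s \<in> X"
  let ?inc = "\<lambda>t u. of_bool (u = fst t) - of_bool (u = fst (snd t)) :: real"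
  have fin: "finite X" using X finite_gain_elements by (rule finite_subset)
  have "u < r" using ends_subset[of t r c] X t u by blast
  have "(\<Sum>t\<in>X. a t * ?inc t u) = 0"
    using gain_relation_balanced[OF X _ _ \<open>u < r\<close>] a \<open>u < r\<close> by auto
  moreover have "?inc s u = 0" if "s \<in> X - {t}" for s
    using others[OF that] by (cases s) (auto split: if_splits)
  moreover have "?inc t u \<noteq> 0" using u by (cases t) (auto split: if_splits)
  ultimately have at: "a t = 0" using fin t by (simp add: sum.remove[of X t])
  show "a s = 0"
  proof (cases "s = t")
    case False
    have "(\<Sum>t\<in>X - {t}. a t * real_of_int (gain_vec t u)) = 0" if "u < r" for u
      using a at fin t that by (simp add: sum.remove[of X t])
    then show ?thesis using indep_familyD[OF ind, of a s] s False by auto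
  qed (simp add: at)
qed

lemma gain_indep_singleton:
  assumes t: "t \<in> gain_elements r c" and r: "0 < r"
  shows "gain_indep r {t}"
proof (cases "t = apex")
  case True
  then show ?thesis using r by (auto simp: indep_family_def)
next
  case False
  then obtain u where u: "u \<in> ends t" using ends_empty_iff[OF t] by auto
  show ?thesis
    by (rule gain_indep_leaf[of "{t}" r c t u]) (use t u in \<open>auto simp: indep_family_def\<close>)
qed

text \<open>If one element has an end that the other lacks, that end is a leaf. Otherwise distinct
  elements are parallel edges, and these differ in their gains.\<close>

lemma gain_indep_pair:
  assumes s: "s \<in> gain_elements r c" and t: "t \<in> gain_elements r c" and r: "0 < r"
  shows "gain_indep r {s, t}"
proof -
  consider "s = t" | u where "s \<noteq> t" "u \<in> ends s" "u \<notin> ends t"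
    | u where "s \<noteq> t" "u \<in> ends t" "u \<notin> ends s" | "s \<noteq> t" "ends s = ends t" by blast
  then show ?thesis
  proof cases
    case 1
    then show ?thesis using gain_indep_singleton[OF s r] by simp
  next
    case (2 u)
    then have "{s, t} - {s} = {t}" by auto
    then show ?thesis
      using gain_indep_leaf[of "{s, t}" r c s u] gain_indep_singleton[OF t r] s t 2 by simp
  next
    case (3 u)
    then have "{s, t} - {t} = {s}" by auto
    then show ?thesis
      using gain_indep_leaf[of "{s, t}" r c t u] gain_indep_singleton[OF s r] s t 3 by simp
  next
    case 4
    obtain i j g where seq: "s = (i, j, g)" by (cases s)
    obtain k l h where t_eq: "t = (k, l, h)" by (cases t)
    have "i = k \<and> j = l" using ends_eqD[of i j g r c k l h] 4(2) s t unfolding seq t_eq by blast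
    with t_eq have teq: "t = (i, j, h)" by simp
    have gh: "g \<noteq> h" using 4(1) seq teq by auto
    have ij: "i < j" "j < r" using 4(1) gh s t seq teq by (auto simp: gain_elements_iff)
    show ?thesis
      unfolding indep_family_def
    proof (intro allI impI ballI)
      fix a x assume a: "\<forall>u<r. (\<Sum>t\<in>{s, t}. a t * real_of_int (gain_vec t u)) = 0" and x: "x \<in> {s, t}"
      have "a s * g + a t * h = 0" using a r 4(1) by (auto simp: seq teq)
      \<comment> \<open>The larger endpoint \<open>j\<close> is positive and therefore has a
        coordinate.\<close>
      moreover have "a s + a t = 0" using a[rule_format, of j] ij 4(1) by (simp add: seq teq)
      then have at: "a t = - a s" by simp
      ultimately have "a s * (real_of_int g - real_of_int h) = 0" by (simp add: algebra_simps)
      then have "a s = 0" using gh by simp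
      with at x show "a x = 0" by auto
    qed
  qed
qed

section \<open>Lines with at least four points\<close>

lemma collinear_gain_ends:
  assumes X: "collinear (gain_matroid r c) X" and T: "{s, t, x} \<subseteq> X" "s \<noteq> t" "s \<noteq> x" "t \<noteq> x"
  shows "ends s \<subseteq> ends t \<union> ends x"
proof
  fix u assume u: "u \<in> ends s"
  have sub: "{s, t, x} \<subseteq> gain_elements r c" using X T by (auto simp: collinear_def gain_matroid_def)
  have r: "0 < r" using ends_subset[of s r c] sub u by auto
  have "\<not> gain_indep r {s, t, x}"
    using X T sub by (auto simp: collinear_def gain_matroid_def)
  moreover have "gain_indep r ({s, t, x} - {s})"
  proof -
    have "{s, t, x} - {s} = {t, x}" using T by auto
    then show ?thesis using gain_indep_pair[of t r c x] sub r by simp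
  qed
  \<comment> \<open>An end of \<open>s\<close> alone would make the triple independent, because the
    remaining pair is.\<close>
  ultimately show "u \<in> ends t \<union> ends x"
    using gain_indep_leaf[OF sub, of s u] u by auto
qed

text \<open>Suppose that \<open>s\<close> and \<open>t\<close>, neither the apex, have different
  ends, and let \<open>D\<close> be the symmetric difference of these. Every further element must
  have ends \<open>D\<close>. Two further elements then force the ends of \<open>s\<close> and
  \<open>t\<close> into \<open>D\<close>; so they are disjoint, and four vertices lie in the
  two-element set \<open>D\<close>.\<close>

lemma collinear_gain_line:
  assumes X: "collinear (gain_matroid r c) X" and card: "4 \<le> card X"
  shows "\<exists>p\<in>vertex_pairs r. X \<subseteq> insert apex (parallel_edges c p)"
proof -
  have sub: "X \<subseteq> gain_elements r c" using X by (simp add: collinear_def gain_matroid_def)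
  have fin: "finite X" using card by (metis card.infinite not_numeral_le_zero)
  have same: "ends s = ends t" if s: "s \<in> X" "s \<noteq> apex" and t: "t \<in> X" "t \<noteq> apex" for s t
  proof (rule ccontr)
    assume ne: "ends s \<noteq> ends t"
    then have st: "s \<noteq> t" by auto
    define D where "D = (ends s - ends t) \<union> (ends t - ends s)"
    have cs: "card (ends s) = 2" "card (ends t) = 2" using card_ends sub s t by blast+
    have "\<not> ends s \<subseteq> ends t" "\<not> ends t \<subseteq> ends s"
      using card_subset_eq[of "ends t" "ends s"] card_subset_eq[of "ends s" "ends t"] cs ne by auto
    then have D2: "2 \<le> card D"
    proof -
      obtain u v where "u \<in> ends s - ends t" "v \<in> ends t - ends s"
        using \<open>\<not> ends s \<subseteq> ends t\<close> \<open>\<not> ends t \<subseteq> ends s\<close> by blast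
      then have "{u, v} \<subseteq> D" "u \<noteq> v" by (auto simp: D_def)
      then show ?thesis using card_mono[of D "{u, v}"] by (simp add: D_def)
    qed
    have ends_x: "ends x = D" if x: "x \<in> X - {s, t}" for x
    proof -
      have "ends s \<subseteq> ends t \<union> ends x" "ends t \<subseteq> ends s \<union> ends x"
        using collinear_gain_ends[OF X, of s t x] collinear_gain_ends[OF X, of t s x] x s t st by auto
      then have sub_x: "D \<subseteq> ends x" by (auto simp: D_def)
      then have "x \<noteq> apex" using D2 by auto
      then have "card (ends x) = 2" using card_ends sub x by blast
      then show ?thesis using card_seteq[OF finite_ends sub_x] D2 by simp
    qed
    \<comment> \<open>One further element would not suffice: a balanced triangle is a collinear set
      of three edges.\<close>
    have "2 \<le> card (X - {s, t})" using card st s t fin by (simp add: card_Diff_subset)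
    then obtain U where "U \<subseteq> X - {s, t}" "card U = 2" using obtain_subset_with_card_n by metis
    then obtain x y where xy: "x \<in> X - {s, t}" "y \<in> X - {s, t}" "x \<noteq> y"
      by (auto simp: card_2_iff)
    have "ends s \<subseteq> D" "ends t \<subseteq> D"
      using collinear_gain_ends[OF X, of s x y] collinear_gain_ends[OF X, of t x y]
        ends_x[OF xy(1)] ends_x[OF xy(2)] xy s t by auto
    then have "ends s \<inter> ends t = {}" by (auto simp: D_def)
    then have "card (ends s \<union> ends t) = 4" using cs by (simp add: card_Un_disjoint)
    moreover have "card (ends s \<union> ends t) \<le> card D"
      using \<open>ends s \<subseteq> D\<close> \<open>ends t \<subseteq> D\<close> by (intro card_mono) (auto simp: D_def)
    moreover have "card D = 2"
    proof -
      have "D \<noteq> {}" using D2 by auto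
      then have "x \<noteq> apex" using ends_x[OF xy(1)] by auto
      then show ?thesis using card_ends[of x r c] sub xy(1) ends_x[OF xy(1)] by auto
    qed
    ultimately show False by simp
  qed
  have "X - {apex} \<noteq> {}"
  proof
    assume "X - {apex} = {}"
    then have "card X \<le> card {apex}" by (intro card_mono) auto
    then show False using card by simp
  qed
  then obtain x where x: "x \<in> X" "x \<noteq> apex" by blast
  obtain i j g where "x = (i, j, g)" by (cases x)
  with x have t: "(i, j, g) \<in> X" "(i, j, g) \<noteq> apex" by simp_all
  have "(i, j) \<in> vertex_pairs r"
    using t sub by (auto simp: gain_elements_iff vertex_pairs_def)
  moreover have "s \<in> insert apex (parallel_edges c (i, j))" if s: "s \<in> X" for s
  proof (cases "s = apex")
    case False
    obtain k l h where seq: "s = (k, l, h)" by (cases s)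
    have "k = i \<and> l = j"
      using ends_eqD[of k l h r c i j g] same[OF s False t] s t sub seq by auto
    moreover have "(k, l, h) \<in> gain_elements r c" using s sub seq by auto
    ultimately show ?thesis using False seq by (auto simp: gain_elements_iff)
  qed simp
  ultimately show ?thesis by blast
qed

text \<open>All these vectors lie in the plane spanned by the unit vector of the gain coordinate and
  the incidence vector of the pair.\<close>

lemma collinear_parallel_edges:
  assumes p: "p \<in> vertex_pairs r"
  shows "collinear (gain_matroid r c) (insert apex (parallel_edges c p))"
proof -
  obtain i j where pij: "p = (i, j)" by (cases p)
  have ij: "i < j" "j < r" using p by (auto simp: pij vertex_pairs_def)
  have "insert apex (parallel_edges c p) \<subseteq> gain_elements r c" using p by (auto simp: gain_elements_def)
  moreover have "\<not> gain_indep r T" if T: "T \<subseteq> insert apex (parallel_edges c p)" "card T = 3" for T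
  proof
    assume ind: "gain_indep r T"
    \<comment> \<open>The two coordinates in that plane, indexed by \<open>bool\<close>: the gain,
      and the multiple of the incidence vector, which is 0 for the apex and 1 for an edge.\<close>
    define m where "m b t = (if b then real_of_int (snd (snd t)) else of_bool (t \<noteq> apex))"
      for b and t :: "nat \<times> nat \<times> int"
    have "finite T" using T(2) by (metis card.infinite zero_neq_numeral)
    moreover have "card (UNIV :: bool set) < card T" using T(2) by simp
    ultimately obtain b t where t: "t \<in> T" "b t \<noteq> 0"
      and b: "\<And>x. (\<Sum>t\<in>T. b t * m x t) = 0"
      using nontrivial_solution[of "UNIV :: bool set" T m] finite[of "UNIV :: bool set"] by blast
    have "(\<Sum>t\<in>T. b t * real_of_int (gain_vec t u)) = 0" for u
    proof (cases "u = 0")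
      case True
      have "real_of_int (gain_vec t u) = m True t" for t using True by (cases t) (simp add: m_def)
      then show ?thesis using b by simp
    next
      case False
      have "real_of_int (gain_vec t u) = (of_bool (u = i) - of_bool (u = j)) * m False t" if "t \<in> T" for t
        using False T(1) that ij by (auto simp: m_def pij)
      then have "(\<Sum>t\<in>T. b t * real_of_int (gain_vec t u))
          = (of_bool (u = i) - of_bool (u = j)) * (\<Sum>t\<in>T. b t * m False t)"
        by (simp add: sum_distrib_left mult_ac)
      then show ?thesis using b by simp
    qed
    from indep_familyD[OF ind this t(1)] t(2) show False by simp
  qed
  ultimately show ?thesis by (auto simp: collinear_def gain_matroid_def)
qed

lemma card_line:
  assumes "(i, j) \<in> vertex_pairs r"
  shows "card (insert apex (parallel_edges c (i, j))) = c i + c j + 2"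
  using assms by (simp add: vertex_pairs_def card_cartesian_product nat_add_distrib)

lemma line_subsetD:
  assumes "p \<in> vertex_pairs r"
    and "insert apex (parallel_edges c p) \<subseteq> insert apex (parallel_edges c q)"
  shows "p = q"
proof -
  \<comment> \<open>Every parallel class contains the edge of gain 0.\<close>
  have "(fst p, snd p, 0) \<in> insert apex (parallel_edges c q)"
    using subsetD[OF assms(2), of "(fst p, snd p, 0)"] by (cases p) auto
  then show "p = q" using assms(1) by (cases p; cases q) (auto simp: vertex_pairs_def)
qed

text \<open>A collinear set of at least four points lies in the line of some pair, and a line
  determines its pair. Lines of three points are excluded because they may also be
  triangles.\<close>

lemma card_max_collinear_gain_matroid:
  assumes "4 \<le> s"
  shows "card (max_collinear (gain_matroid r c) s)
    = card {p \<in> vertex_pairs r. c (fst p) + c (snd p) + 2 = s}"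
proof -
  let ?L = "\<lambda>p. insert apex (parallel_edges c p)"
  let ?P = "{p \<in> vertex_pairs r. c (fst p) + c (snd p) + 2 = s}"
  have "max_collinear (gain_matroid r c) s = ?L ` ?P"
  proof (intro equalityI subsetI)
    fix X assume "X \<in> max_collinear (gain_matroid r c) s"
    then have X: "card X = s" "collinear (gain_matroid r c) X"
      "\<And>Y. collinear (gain_matroid r c) Y \<Longrightarrow> X \<subseteq> Y \<Longrightarrow> Y = X"
      by (auto simp: max_collinear_def)
    obtain p where p: "p \<in> vertex_pairs r" "X \<subseteq> ?L p"
      using collinear_gain_line[OF X(2)] X(1) assms by auto
    have "?L p = X" using X(3)[OF collinear_parallel_edges[OF p(1)] p(2)] .
    moreover have "p \<in> ?P"
      using p(1) X(1) card_line[of "fst p" "snd p" r c] \<open>?L p = X\<close> by simp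
    ultimately show "X \<in> ?L ` ?P" by blast
  next
    fix X assume "X \<in> ?L ` ?P"
    then obtain p where p: "p \<in> vertex_pairs r" "c (fst p) + c (snd p) + 2 = s" and X: "X = ?L p" by auto
    have cX: "card X = s" using card_line[of "fst p" "snd p" r c] p X by simp
    have "Y = X" if Y: "collinear (gain_matroid r c) Y" "X \<subseteq> Y" for Y
    proof -
      have "finite Y" using Y(1) finite_subset[OF _ finite_gain_elements[of r c]]
        by (auto simp: collinear_def gain_matroid_def)
      then have "4 \<le> card Y" using card_mono[OF _ Y(2)] cX assms by simp
      then obtain q where q: "q \<in> vertex_pairs r" "Y \<subseteq> ?L q"
        using collinear_gain_line[OF Y(1)] by auto
      then have "p = q" using line_subsetD[OF p(1)] Y(2) X by blast
      then show ?thesis using q Y(2) X by auto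
    qed
    then show "X \<in> max_collinear (gain_matroid r c) s"
      using cX X collinear_parallel_edges[OF p(1)] by (auto simp: max_collinear_def)
  qed
  moreover have "inj_on ?L ?P" using line_subsetD by (intro inj_onI) blast
  ultimately show ?thesis by (simp add: card_image)
qed

section \<open>Recovering the weights from the pair sums\<close>

lemma vertex_pairs_Suc:
  "vertex_pairs (Suc r) = vertex_pairs r \<union> (\<lambda>i. (i, r)) ` {..<r}"
  by (auto simp: vertex_pairs_def less_Suc_eq)

lemma sum_vertex_pairs_Suc:
  "sum f (vertex_pairs (Suc r)) = sum f (vertex_pairs r) + (\<Sum>i<r. f (i, r))"
proof -
  have "sum f (vertex_pairs (Suc r)) = sum f (vertex_pairs r) + sum f ((\<lambda>i. (i, r)) ` {..<r})"
    unfolding vertex_pairs_Suc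
    by (intro sum.union_disjoint finite_vertex_pairs finite_imageI finite_lessThan)
      (auto simp: vertex_pairs_def)
  also have "sum f ((\<lambda>i. (i, r)) ` {..<r}) = (\<Sum>i<r. f (i, r))"
    by (subst sum.reindex) (auto simp: inj_on_def)
  finally show ?thesis .
qed

lemma vertex_pairs_0 [simp]: "vertex_pairs 0 = {}"
  by (auto simp: vertex_pairs_def)

lemma card_vertex_pairs: "card (vertex_pairs r) = r choose 2"
proof (induction r)
  case (Suc r)
  then show ?case
    using sum_vertex_pairs_Suc[of "\<lambda>_. 1 :: nat" r] by (simp add: numeral_2_eq_2)
qed (simp add: numeral_2_eq_2)

text \<open>Every vertex lies in \<open>r - 1\<close> of the pairs.\<close>

lemma sum_weights_vertex_pairs:
  fixes c :: "nat \<Rightarrow> nat"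
  shows "(\<Sum>p\<in>vertex_pairs r. c (fst p) + c (snd p)) = (r - 1) * (\<Sum>i<r. c i)"
proof (induction r)
  case (Suc r)
  then show ?case by (cases r) (simp_all add: sum_vertex_pairs_Suc sum.distrib algebra_simps)
qed simp

text \<open>The apex counts once, and a pair \<open>(i, j)\<close> contributes
  \<open>1 + (c i + c j)\<close> edges.\<close>

lemma card_gain_elements:
  "card (gain_elements r c) = 1 + (r choose 2) + (r - 1) * (\<Sum>i<r. c i)"
proof -
  let ?U = "\<Union>p\<in>vertex_pairs r. parallel_edges c p"
  have "apex \<notin> ?U" by (auto simp: vertex_pairs_def)
  then have "card (gain_elements r c) = 1 + card ?U"
    unfolding gain_elements_def by (subst card_insert_disjoint) auto
  also have "card ?U = (\<Sum>p\<in>vertex_pairs r. card (parallel_edges c p))"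
  proof (rule card_UN_disjoint)
    show "\<forall>p\<in>vertex_pairs r. \<forall>q\<in>vertex_pairs r. p \<noteq> q \<longrightarrow> parallel_edges c p \<inter> parallel_edges c q = {}"
      by (auto simp: split_paired_all)
  qed auto
  also have "\<dots> = (\<Sum>p\<in>vertex_pairs r. 1 + (c (fst p) + c (snd p)))"
  proof (rule sum.cong[OF refl])
    fix p
    show "card (parallel_edges c p) = 1 + (c (fst p) + c (snd p))"
      by (cases p) (simp add: card_cartesian_product nat_add_distrib)
  qed
  also have "\<dots> = (r choose 2) + (r - 1) * (\<Sum>i<r. c i)"
    by (subst sum.distrib) (simp add: card_vertex_pairs sum_weights_vertex_pairs)
  finally show ?thesis by simp
qed

section \<open>Counts of pairs by weight sum\<close>

definition pair_count :: "nat \<Rightarrow> (nat \<Rightarrow> nat) \<Rightarrow> nat \<Rightarrow> nat" where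
  "pair_count r c s = card {p \<in> vertex_pairs r. c (fst p) + c (snd p) = s}"

text \<open>Groups the pairs by weight sum. With \<open>h\<close> the identity this yields the total
  of all pair sums, with \<open>h\<close> constant 1 the number of pairs.\<close>

lemma sum_pair_count:
  assumes "\<And>p. p \<in> vertex_pairs r \<Longrightarrow> c (fst p) + c (snd p) \<le> N"
  shows "(\<Sum>s\<le>N. h s * pair_count r c s) = (\<Sum>p\<in>vertex_pairs r. h (c (fst p) + c (snd p)))"
proof -
  let ?f = "\<lambda>p. c (fst p) + c (snd p)"
  have "(\<Sum>s\<le>N. h s * pair_count r c s) = (\<Sum>s\<le>N. \<Sum>p\<in>{p \<in> vertex_pairs r. ?f p = s}. h (?f p))"
    by (intro sum.cong) (auto simp: pair_count_def)
  also have "\<dots> = (\<Sum>p\<in>vertex_pairs r. h (?f p))"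
    using assms by (intro sum.group) auto
  finally show ?thesis .
qed

text \<open>
  The number of pairs of weight sum 1 and 0 are recovered from the total weight and the number of
  all pairs.
\<close>

lemma pair_count_eq:
  assumes sums: "(\<Sum>i<r. c i) = (\<Sum>i<r. d i)"
    and ge2: "\<And>s. 2 \<le> s \<Longrightarrow> pair_count r c s = pair_count r d s"
  shows "pair_count r c s = pair_count r d s"
proof -
  define f where "f c p = c (fst p) + c (snd p)" for c :: "nat \<Rightarrow> nat" and p :: "nat \<times> nat"
  \<comment> \<open>A common bound for all pair sums; the summand 2 ensures that 0 and 1 lie in the
    range of summation.\<close>
  define N where "N = sum (f c) (vertex_pairs r) + sum (f d) (vertex_pairs r) + 2"
  have le: "f c p \<le> N" "f d p \<le> N" if "p \<in> vertex_pairs r" for p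
    using member_le_sum[OF that, of "f c"] member_le_sum[OF that, of "f d"] by (auto simp: N_def)
  have split: "(\<Sum>s\<le>N. h s * x s) = h 0 * x 0 + h 1 * x 1 + (\<Sum>s=2..N. h s * x s)" for h x :: "nat \<Rightarrow> nat"
  proof -
    have "{..N} = {0, 1} \<union> {2..N}" by (auto simp: N_def)
    then have "(\<Sum>s\<le>N. h s * x s) = (\<Sum>s\<in>{0, 1}. h s * x s) + (\<Sum>s=2..N. h s * x s)"
      by (simp only:) (intro sum.union_disjoint, auto)
    then show ?thesis by simp
  qed
  have tail: "(\<Sum>s=2..N. h s * pair_count r c s) = (\<Sum>s=2..N. h s * pair_count r d s)" for h
    using ge2 by (intro sum.cong) auto
  have total: "(\<Sum>s\<le>N. h s * pair_count r c s) = (\<Sum>p\<in>vertex_pairs r. h (f c p))"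
    "(\<Sum>s\<le>N. h s * pair_count r d s) = (\<Sum>p\<in>vertex_pairs r. h (f d p))" for h
    using le by (auto simp: f_def intro!: sum_pair_count)
  \<comment> \<open>The factor \<open>s\<close> kills the unknown count at 0 and leaves the one at 1
    alone; the unweighted sum then yields the count at 0.\<close>
  have "(\<Sum>s\<le>N. s * pair_count r c s) = (\<Sum>s\<le>N. s * pair_count r d s)"
    using total[of "\<lambda>s. s"] sums by (simp add: f_def sum_weights_vertex_pairs)
  then have one: "pair_count r c 1 = pair_count r d 1"
    using split[of "\<lambda>s. s"] tail[of "\<lambda>s. s"] by simp
  have "(\<Sum>s\<le>N. 1 * pair_count r c s) = (\<Sum>s\<le>N. 1 * pair_count r d s)"
    using total[of "\<lambda>_. 1"] by simp
  then have "pair_count r c 0 = pair_count r d 0"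
    using split[of "\<lambda>_. 1"] tail[of "\<lambda>_. 1"] one by simp
  with one ge2 show ?thesis
    by (metis One_nat_def Suc_1 Suc_leI less_one not_less not_less_eq_eq order_class.order_eq_iff)
qed

section \<open>Multiplicities of weights\<close>

definition weight_mult :: "nat \<Rightarrow> (nat \<Rightarrow> nat) \<Rightarrow> nat \<Rightarrow> nat" where
  "weight_mult r c k = card {i. i < r \<and> c i = k}"

text \<open>Both sides count the ordered pairs of vertices with weight sum \<open>s\<close>: by the
  weight of the first vertex, and as two orders of each vertex pair plus the diagonal.\<close>

lemma convolution_weight_mult:
  "(\<Sum>a\<le>s. weight_mult r c a * weight_mult r c (s - a)) = 2 * pair_count r c s + card {i. i < r \<and> 2 * c i = s}"
proof -
  define S where "S = {(i, j). i < r \<and> j < r \<and> c i + c j = s}"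
  define P where "P = {p \<in> vertex_pairs r. c (fst p) + c (snd p) = s}"
  define Q where "Q = {i. i < r \<and> 2 * c i = s}"
  have "S = (\<Union>a\<in>{..s}. {i. i < r \<and> c i = a} \<times> {j. j < r \<and> c j = s - a})"
    by (auto simp: S_def)
  then have "card S = (\<Sum>a\<le>s. card ({i. i < r \<and> c i = a} \<times> {j. j < r \<and> c j = s - a}))"
    by (simp only:) (intro card_UN_disjoint, auto)
  then have "card S = (\<Sum>a\<le>s. weight_mult r c a * weight_mult r c (s - a))"
    by (simp add: card_cartesian_product weight_mult_def)
  moreover have "card S = 2 * card P + card Q"
  proof -
    have fin: "finite P" "finite Q" by (auto simp: P_def Q_def)
    have S_eq: "S = (P \<union> prod.swap ` P) \<union> (\<lambda>i. (i, i)) ` Q"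
    proof (intro equalityI subsetI)
      fix x assume "x \<in> S"
      then obtain i j where x: "x = (i, j)" "i < r" "j < r" "c i + c j = s" by (auto simp: S_def)
      consider "i < j" | "i = j" | "j < i" by linarith
      then show "x \<in> (P \<union> prod.swap ` P) \<union> (\<lambda>i. (i, i)) ` Q"
      proof cases
        case 3
        then have "(j, i) \<in> P" using x by (simp add: P_def vertex_pairs_def add.commute)
        then have "prod.swap (j, i) \<in> prod.swap ` P" by (rule imageI)
        then show ?thesis using x by simp
      qed (use x in \<open>auto simp: P_def Q_def vertex_pairs_def\<close>)
    qed (auto simp: S_def P_def Q_def vertex_pairs_def)
    have "card S = card (P \<union> prod.swap ` P) + card ((\<lambda>i. (i, i)) ` Q)"
      unfolding S_eq using fin by (intro card_Un_disjoint) (auto simp: P_def vertex_pairs_def)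
    also have "card (P \<union> prod.swap ` P) = card P + card (prod.swap ` P)"
      using fin by (intro card_Un_disjoint) (auto simp: P_def vertex_pairs_def)
    also have "card (prod.swap ` P) = card P" by (intro card_image) simp
    also have "card ((\<lambda>i. (i, i)) ` Q) = card Q" by (intro card_image) (simp add: inj_on_def)
    finally show ?thesis by simp
  qed
  ultimately show ?thesis by (simp add: pair_count_def P_def Q_def)
qed

text \<open>
  In the convolution for \<open>k > 0\<close> the unknown \<open>weight_mult r c k\<close> occurs linearly with coefficient
  \<open>2 * weight_mult r c 0\<close>, which is positive because vertex 0 has weight 0.
\<close>

lemma weight_mult_eq:
  assumes r: "0 < r" and zero: "c 0 = 0" "d 0 = 0"
    and pc: "\<And>s. pair_count r c s = pair_count r d s"
  shows "weight_mult r c k = weight_mult r d k"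
proof (induction k rule: less_induct)
  case (less k)
  have pos: "0 < weight_mult r c 0" "0 < weight_mult r d 0"
    unfolding weight_mult_def using r zero by (auto simp: card_gt_0_iff)
  show ?case
  proof (cases "k = 0")
    case True
    have conv0: "weight_mult r c 0 * weight_mult r c 0 = 2 * pair_count r c 0 + weight_mult r c 0" for c
      using convolution_weight_mult[where s = 0] by (simp add: weight_mult_def)
    \<comment> \<open>Both multiplicities \<open>x\<close> satisfy
      \<open>x * x - x = 2 * pair_count r c 0\<close>. As they are positive, the second factor of
      the difference cannot vanish.\<close>
    have "(int (weight_mult r c 0) - int (weight_mult r d 0)) * (int (weight_mult r c 0) + int (weight_mult r d 0) - 1) = 0"
      using arg_cong[OF conv0[of c], of int] arg_cong[OF conv0[of d], of int] pc[of 0]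
      by (simp add: algebra_simps)
    then show ?thesis using pos True by auto
  next
    case False
    \<comment> \<open>The diagonal term is the multiplicity of \<open>k div 2\<close>, which is
      smaller than \<open>k\<close>, or 0 for odd \<open>k\<close>.\<close>
    have half: "card {i. i < r \<and> 2 * c i = k} = card {i. i < r \<and> 2 * d i = k}"
    proof (cases "even k")
      case True
      then have "{i. i < r \<and> 2 * c i = k} = {i. i < r \<and> c i = k div 2}"
        "{i. i < r \<and> 2 * d i = k} = {i. i < r \<and> d i = k div 2}" by auto
      then show ?thesis using less[of "k div 2"] False by (simp add: weight_mult_def)
    next
      case False
      then have "{i. i < r \<and> 2 * c i = k} = {}" "{i. i < r \<and> 2 * d i = k} = {}" by auto
      then show ?thesis by (simp only:)
    qed
    have split: "(\<Sum>a\<le>k. m a * m (k - a)) = 2 * (m 0 * m k) + (\<Sum>a\<in>{0<..<k}. m a * m (k - a))"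
      for m :: "nat \<Rightarrow> nat"
    proof -
      have "{..k} = {0, k} \<union> {0<..<k}" using False by auto
      then have "(\<Sum>a\<le>k. m a * m (k - a)) = (\<Sum>a\<in>{0, k}. m a * m (k - a)) + (\<Sum>a\<in>{0<..<k}. m a * m (k - a))"
        by (simp only:) (intro sum.union_disjoint, auto)
      then show ?thesis using False by simp
    qed
    have "(\<Sum>a\<in>{0<..<k}. weight_mult r c a * weight_mult r c (k - a)) = (\<Sum>a\<in>{0<..<k}. weight_mult r d a * weight_mult r d (k - a))"
      using less by (intro sum.cong) auto
    then have "weight_mult r c 0 * weight_mult r c k = weight_mult r d 0 * weight_mult r d k"
      using convolution_weight_mult[of r c k] convolution_weight_mult[of r d k] half pc[of k]
      unfolding split by simp
    then show ?thesis using less[of 0] pos False by simp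
  qed
qed

text \<open>The shift by one keeps vertex 0 at weight 0, on which the determinant bound and the
  recovery of the weights rely; vertices beyond the list are padded with 0.\<close>

definition weights :: "nat list \<Rightarrow> nat \<Rightarrow> nat" where
  "weights xs i = (if 0 < i \<and> i \<le> length xs then xs ! (i - 1) else 0)"

lemma sum_weights:
  assumes "length xs < r"
  shows "(\<Sum>i<r. weights xs i) = sum_list xs"
proof -
  obtain q where r: "r = Suc q" "length xs \<le> q" using assms by (cases r) auto
  have "(\<Sum>i<r. weights xs i) = (\<Sum>i<q. weights xs (Suc i))"
    unfolding r(1) by (subst sum.lessThan_Suc_shift) (simp add: weights_def)
  also have "\<dots> = (\<Sum>i<length xs. xs ! i)"
    using r(2) by (intro sum.mono_neutral_cong_right) (auto simp: weights_def)
  finally show ?thesis by (simp add: sum_list_sum_nth lessThan_atLeast0)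
qed

lemma weight_mult_weights:
  assumes "length xs < r" and "0 < k"
  shows "weight_mult r (weights xs) k = count (mset xs) k"
proof -
  have "{i. i < r \<and> weights xs i = k} = Suc ` {i. i < length xs \<and> xs ! i = k}"
  proof (intro equalityI subsetI)
    fix i assume "i \<in> {i. i < r \<and> weights xs i = k}"
    then have "0 < i" "i - 1 < length xs" "xs ! (i - 1) = k"
      using assms(2) by (auto simp: weights_def split: if_splits)
    then show "i \<in> Suc ` {i. i < length xs \<and> xs ! i = k}"
      by (intro image_eqI[of _ _ "i - 1"]) auto
  qed (use assms in \<open>auto simp: weights_def\<close>)
  then have "weight_mult r (weights xs) k = card {i. i < length xs \<and> xs ! i = k}"
    by (simp add: weight_mult_def card_image)
  also have "\<dots> = count (mset xs) k"
    unfolding count_mset count_list_eq_length_filter length_filter_conv_card by (rule arg_cong[of _ _ card]) auto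
  finally show ?thesis .
qed

section \<open>The matroid of a partition\<close>

lemma gain_indep_card_le_2:
  assumes X: "X \<subseteq> gain_elements r c" "finite X" "card X \<le> 2" and r: "0 < r"
  shows "gain_indep r X"
proof -
  consider "card X = 0" | "card X = 1" | "card X = 2" using X(3) by linarith
  then show ?thesis
  proof cases
    case 1
    then show ?thesis using X(2) by (simp add: indep_family_def)
  next
    case 2
    then obtain s where "X = {s}" using card_1_singletonE by blast
    then show ?thesis using gain_indep_singleton[of s r c] X(1) r by simp
  next
    case 3
    then obtain s t where "X = {s, t}" by (auto simp: card_2_iff)
    then show ?thesis using gain_indep_pair[of s r c t] X(1) r by simp
  qed
qed

text \<open>The apex together with the star of edges of gain 0 at vertex 0: each added edge has its
  outer vertex as a leaf.\<close>

lemma gain_basis_exists: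
  assumes "0 < r"
  shows "\<exists>B\<subseteq>gain_elements r c. gain_indep r B \<and> card B = r"
proof -
  let ?B = "\<lambda>k. insert apex ((\<lambda>j. (0, Suc j, 0)) ` {..<k}) :: (nat \<times> nat \<times> int) set"
  have sub: "?B k \<subseteq> gain_elements r c" if "k < r" for k
    using that by (auto simp: gain_elements_iff)
  have "gain_indep r (?B k)" if "k < r" for k
    using that
  proof (induction k)
    case 0
    have "apex \<in> gain_elements r c" by (simp add: gain_elements_iff)
    from gain_indep_singleton[OF this assms] show ?case by simp
  next
    case (Suc k)
    let ?t = "(0, Suc k, 0) :: nat \<times> nat \<times> int"
    have "?B (Suc k) - {?t} = ?B k" by (auto simp: less_Suc_eq)
    then have ind: "gain_indep r (?B (Suc k) - {?t})" using Suc by simp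
    show ?case
    proof (rule gain_indep_leaf[OF sub[OF Suc.prems] _ _ _ ind])
      show "?t \<in> ?B (Suc k)" by simp
      show "Suc k \<in> ends ?t" by simp
      show "Suc k \<notin> ends s" if "s \<in> ?B (Suc k) - {?t}" for s
        using that unfolding \<open>?B (Suc k) - {?t} = ?B k\<close> by auto
    qed
  qed
  moreover have "card (?B k) = Suc k" for k
  proof -
    have "card ((\<lambda>j. (0, Suc j, 0)) ` {..<k} :: (nat \<times> nat \<times> int) set) = k"
      by (simp add: card_image inj_on_def)
    moreover have "apex \<notin> (\<lambda>j. (0, Suc j, 0)) ` {..<k}" by auto
    ultimately show ?thesis by (subst card_insert_disjoint) auto
  qed
  ultimately show ?thesis
    using sub[of "r - 1"] assms by (intro exI[of _ "?B (r - 1)"]) auto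
qed

section \<open>The integer matrix of a gain matroid\<close>

definition gain_list :: "nat \<Rightarrow> (nat \<Rightarrow> nat) \<Rightarrow> (nat \<times> nat \<times> int) list" where
  "gain_list r c = (SOME ts. distinct ts \<and> set ts = gain_elements r c)"

lemma gain_list: "distinct (gain_list r c)" "set (gain_list r c) = gain_elements r c"
proof -
  have "\<exists>ts. distinct ts \<and> set ts = gain_elements r c"
    using finite_distinct_list[OF finite_gain_elements] by blast
  from someI_ex[OF this] show "distinct (gain_list r c)" "set (gain_list r c) = gain_elements r c"
    by (simp_all add: gain_list_def)
qed

definition gain_mat :: "nat \<Rightarrow> (nat \<Rightarrow> nat) \<Rightarrow> int mat" where
  "gain_mat r c = mat r (length (gain_list r c)) (\<lambda>(u, k). gain_vec (gain_list r c ! k) u)"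

abbreviation gain_vector_matroid :: "nat \<Rightarrow> (nat \<Rightarrow> nat) \<Rightarrow> nat indep_system" where
  "gain_vector_matroid r c \<equiv> vector_matroid (map_mat real_of_int (gain_mat r c))"

lemma dim_gain_mat [simp]:
  "dim_row (gain_mat r c) = r" "dim_col (gain_mat r c) = length (gain_list r c)"
  by (simp_all add: gain_mat_def)

lemma bij_betw_gain_list:
  "bij_betw ((!) (gain_list r c)) {..<length (gain_list r c)} (gain_elements r c)"
  using bij_betw_nth[OF gain_list(1) refl] gain_list(2) by metis

lemma indep_gain_vector_matroid:
  assumes X: "X \<subseteq> {..<length (gain_list r c)}"
  shows "X \<in> indeps (gain_vector_matroid r c) \<longleftrightarrow> gain_indep r ((!) (gain_list r c) ` X)"
proof -
  let ?f = "(!) (gain_list r c)"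
  have "inj_on ?f X" using bij_betw_gain_list X by (meson bij_betw_def inj_on_subset)
  then have "gain_indep r (?f ` X) \<longleftrightarrow> indep_family r ((\<lambda>t u. real_of_int (gain_vec t u)) \<circ> ?f) X"
    by (rule indep_family_image)
  also have "\<dots> \<longleftrightarrow> indep_family r (\<lambda>j u. map_mat real_of_int (gain_mat r c) $$ (u, j)) X"
    using X by (intro indep_family_cong) (auto simp: gain_mat_def subset_iff simp del: gain_vec.simps)
  finally show ?thesis using X by (simp add: indep_vector_matroid_iff)
qed

lemma gain_vector_matroid_iso: "matroid_iso (gain_vector_matroid r c) (gain_matroid r c)"
proof -
  have "(!) (gain_list r c) ` X \<subseteq> gain_elements r c" if "X \<subseteq> {..<length (gain_list r c)}" for X
    using that gain_list(2)[of r c] nth_mem by fastforce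
  then show ?thesis
    unfolding matroid_iso_def
    by (intro exI[of _ "(!) (gain_list r c)"] conjI allI impI)
      (simp_all add: bij_betw_gain_list indep_gain_vector_matroid gain_matroid_def)
qed

lemma gain_vector_matroid_basis:
  assumes "0 < r"
  shows "\<exists>J\<in>indeps (gain_vector_matroid r c). card J = r"
proof -
  let ?f = "(!) (gain_list r c)"
  obtain B where B: "B \<subseteq> gain_elements r c" "gain_indep r B" "card B = r"
    using gain_basis_exists[OF assms] by blast
  then obtain J where J: "J \<subseteq> {..<length (gain_list r c)}" "B = ?f ` J"
    using bij_betw_gain_list[of r c] by (metis bij_betw_imp_surj_on subset_image_iff)
  moreover have "card J = r"
    using B(3) J bij_betw_gain_list[of r c] by (metis bij_betw_def card_image inj_on_subset)
  ultimately show ?thesis using B(2) indep_gain_vector_matroid by blast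
qed

lemma simple_gain_vector_matroid:
  assumes "0 < r"
  shows "simple_matroid (gain_vector_matroid r c)"
proof (rule simple_matroidI)
  let ?f = "(!) (gain_list r c)"
  fix X assume X: "X \<subseteq> ground (gain_vector_matroid r c)" "finite X" "card X \<le> 2"
  then have sub: "X \<subseteq> {..<length (gain_list r c)}" by simp
  have "?f ` X \<subseteq> gain_elements r c"
    using sub bij_betw_gain_list[of r c] by (metis bij_betw_imp_surj_on image_mono)
  moreover have "card (?f ` X) \<le> 2" using card_image_le[OF X(2), of ?f] X(3) by simp
  ultimately have "gain_indep r (?f ` X)" using gain_indep_card_le_2 X(2) assms by blast
  then show "X \<in> indeps (gain_vector_matroid r c)" using indep_gain_vector_matroid[OF sub] by simp
qed

lemma pick_lessThan: "u < n \<Longrightarrow> pick {..<n} u = u"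
proof -
  assume u: "u < n"
  have "{a \<in> {..<n}. a < u} = {..<u}" using u by auto
  then have "card {a \<in> {..<n}. a < u} = u" by simp
  then show ?thesis using pick_card_in_set[of u "{..<n}"] u by simp
qed

text \<open>The rank is \<open>r\<close>, so a maximal minor takes all rows and \<open>r\<close>
  columns, and \<open>abs_det_gain_le\<close> applies once every column is presented by an edge
  within the gain bounds. The apex itself violates them, since \<open>c 0 = 0\<close>.\<close>

lemma modular_gain_mat:
  assumes r: "0 < r" and c0: "c 0 = 0" and sum: "(\<Sum>v<r. c v) = \<Delta>" and \<Delta>: "0 < \<Delta>"
  shows "modular_mat \<Delta> (gain_mat r c)"
proof -
  have rank: "mat_rank (gain_mat r c) = r"
  proof -
    obtain J where "J \<in> indeps (gain_vector_matroid r c)" "card J = r"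
      using gain_vector_matroid_basis[OF r] by blast
    then show ?thesis
      using rank_vector_matroid[of J "map_mat real_of_int (gain_mat r c)"] by (simp add: mat_rank_def)
  qed
  \<comment> \<open>At a vertex of positive weight a loop of gain 1 obeys the gain bounds.\<close>
  obtain w where w: "w < r" "0 < c w"
    using sum \<Delta> by (metis gr0I lessThan_iff sum.neutral)
  have "\<bar>det (submatrix (gain_mat r c) I J)\<bar> \<le> int \<Delta>"
    if I: "I \<subseteq> {..<r}" "card I = r" and J: "J \<subseteq> {..<length (gain_list r c)}" "card J = r" for I J
  proof -
    text \<open>In the determinant bound the apex is represented by a loop of gain 1 at \<open>w\<close>.\<close>
    define t where "t k = (let e = gain_list r c ! pick J k in if e = apex then (w, w, 1) else e)" for k
    have I_eq: "I = {..<r}" using card_subset_eq[OF _ I(1)] I(2) by simp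
    have pickJ: "pick J k \<in> J" if "k < r" for k
      using pick_in_set_le[of k J] that J(2) by simp
    have elem: "gain_list r c ! pick J k \<in> gain_elements r c" if "k < r" for k
      using pickJ[OF that] J(1) gain_list(2)[of r c] nth_mem by blast
    have t: "fst (t k) < r" "fst (snd (t k)) < r" "- int (c (fst (snd (t k)))) \<le> snd (snd (t k))"
      "snd (snd (t k)) \<le> int (c (fst (t k)))" if "k < r" for k
    proof -
      obtain i j g where e: "gain_list r c ! pick J k = (i, j, g)" by (metis surj_pair)
      have "fst (t k) < r \<and> fst (snd (t k)) < r \<and> - int (c (fst (snd (t k)))) \<le> snd (snd (t k))
          \<and> snd (snd (t k)) \<le> int (c (fst (t k)))"
        using elem[OF that] w unfolding t_def e by (auto simp: gain_elements_iff)
      then show "fst (t k) < r" "fst (snd (t k)) < r" "- int (c (fst (snd (t k)))) \<le> snd (snd (t k))"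
        "snd (snd (t k)) \<le> int (c (fst (t k)))" by auto
    qed
    \<comment> \<open>The column of a loop does not depend on its vertex.\<close>
    have entry: "gain_vec (gain_list r c ! pick J k) u = gain_vec (t k) u" for u k
      by (simp add: t_def Let_def)
    have dims: "{i. i < r \<and> i \<in> I} = {..<r}" "{j. j < length (gain_list r c) \<and> j \<in> J} = J"
      using I_eq J(1) by auto
    have "submatrix (gain_mat r c) I J
        = mat r r (\<lambda>(u, k). gain_vec (fst (t k), fst (snd (t k)), snd (snd (t k))) u)"
    proof (rule eq_matI)
      fix u k
      assume "u < dim_row (mat r r (\<lambda>(u, k). gain_vec (fst (t k), fst (snd (t k)), snd (snd (t k))) u))"
        and "k < dim_col (mat r r (\<lambda>(u, k). gain_vec (fst (t k), fst (snd (t k)), snd (snd (t k))) u))"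
      then have uk: "u < r" "k < r" by simp_all
      have "submatrix (gain_mat r c) I J $$ (u, k) = gain_mat r c $$ (pick I u, pick J k)"
        using uk J(2) by (intro submatrix_index) (simp_all add: dims)
      also have "\<dots> = gain_vec (gain_list r c ! pick J k) u"
        using uk pickJ[OF uk(2)] J(1) by (auto simp: I_eq pick_lessThan gain_mat_def simp del: gain_vec.simps)
      finally show "submatrix (gain_mat r c) I J $$ (u, k)
          = mat r r (\<lambda>(u, k). gain_vec (fst (t k), fst (snd (t k)), snd (snd (t k))) u) $$ (u, k)"
        using uk by (simp add: entry del: gain_vec.simps)
    qed (simp_all add: dim_submatrix dims J(2))
    then show ?thesis using abs_det_gain_le[OF r c0 t] sum by simp
  qed
  then show ?thesis by (simp add: modular_mat_def rank)
qed

lemma card_max_collinear_gain_vector_matroid: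
  assumes "4 \<le> s"
  shows "card (max_collinear (gain_vector_matroid r c) s) = pair_count r c (s - 2)"
proof -
  have "{p \<in> vertex_pairs r. c (fst p) + c (snd p) + 2 = s} = {p \<in> vertex_pairs r. c (fst p) + c (snd p) = s - 2}"
    using assms by auto
  then show ?thesis
    using card_max_collinear_iso[OF gain_vector_matroid_iso] card_max_collinear_gain_matroid[OF assms]
    by (simp add: pair_count_def)
qed

text \<open>The lines with \<open>s + 2\<close> points, for \<open>s\<close> at least 2, give the
  pair counts at \<open>s\<close>, the common total weight gives the others, and these determine the
  multiplicities of the positive weights, which are the parts.\<close>

lemma gain_vector_matroid_iso_imp_mset_eq:
  assumes iso: "matroid_iso (gain_vector_matroid r (weights xs)) (gain_vector_matroid r (weights ys))"
    and len: "length xs < r" "length ys < r" and zero: "0 \<notin> set xs" "0 \<notin> set ys"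
    and sum: "sum_list xs = sum_list ys"
  shows "mset xs = mset ys"
proof (rule multiset_eqI)
  fix k
  have "pair_count r (weights xs) s = pair_count r (weights ys) s" if "2 \<le> s" for s
    using card_max_collinear_iso[OF iso, of "s + 2"] that
    by (simp add: card_max_collinear_gain_vector_matroid)
  then have pc: "pair_count r (weights xs) s = pair_count r (weights ys) s" for s
    using pair_count_eq[of "weights xs" r "weights ys"] sum len by (simp add: sum_weights)
  show "count (mset xs) k = count (mset ys) k"
  proof (cases "k = 0")
    case True
    then show ?thesis using zero by (metis count_eq_zero_iff set_mset_mset)
  next
    case False
    have "0 < r" using len by simp
    then have "weight_mult r (weights xs) k = weight_mult r (weights ys) k"
      using pc by (intro weight_mult_eq) (simp_all add: weights_def)
    then show ?thesis using weight_mult_weights len False by simp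
  qed
qed

section \<open>Partitions as weights\<close>

definition partitions :: "nat \<Rightarrow> nat multiset set" where
  "partitions n = {P. 0 \<notin># P \<and> sum_mset P = n}"

lemma length_le_sum_list:
  fixes xs :: "nat list"
  assumes "0 \<notin> set xs"
  shows "length xs \<le> sum_list xs"
  using assms by (induction xs) (auto simp: Suc_le_eq)

text \<open>A partition of \<open>n\<close> has at most \<open>n\<close> parts, each at most
  \<open>n\<close>.\<close>

lemma finite_partitions: "finite (partitions n)"
proof (rule finite_subset)
  show "partitions n \<subseteq> mset ` {xs. set xs \<subseteq> {..n} \<and> length xs \<le> n}"
  proof
    fix P assume P: "P \<in> partitions n"
    obtain xs where xs: "P = mset xs" by (metis ex_mset)
    have "0 \<notin> set xs" "sum_list xs = n"
      using P by (auto simp: partitions_def xs sum_mset_sum_list)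
    then have "xs \<in> {xs. set xs \<subseteq> {..n} \<and> length xs \<le> n}"
      using length_le_sum_list[of xs] member_le_sum_list[of _ xs] by auto
    then show "P \<in> mset ` {xs. set xs \<subseteq> {..n} \<and> length xs \<le> n}" using xs by blast
  qed
  show "finite (mset ` {xs. set xs \<subseteq> {..n} \<and> length xs \<le> n})"
    by (intro finite_imageI finite_lists_length_le) simp
qed

theorem theorem1p3:
  fixes \<Delta> r :: nat
  assumes "\<Delta> \<ge> 2" and "r \<ge> 2" and "r \<ge> \<Delta> + 1"
  shows "\<exists>\<M> :: nat indep_system set.
    finite \<M> \<and> card \<M> \<ge> num_partitions (\<Delta> - 1) + 1 \<and>
    (\<forall>M \<in> \<M>. matroid M \<and> simple_matroid M \<and> matroid_rank M = r \<and> modular_matroid \<Delta> M \<and>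
       card (ground M) = ((r + 1) choose 2) + (\<Delta> - 1) * (r - 1)) \<and>
    (\<forall>M \<in> \<M>. \<forall>N \<in> \<M>. M \<noteq> N \<longrightarrow> \<not> matroid_iso M N)"
proof -
  \<comment> \<open>Partitions of \<Delta>. As \<Delta> is at least 2, the one with a single part
    does not contain the part 1, so it adds one to the count.\<close>
  define Q where "Q = insert {#\<Delta>#} (add_mset 1 ` partitions (\<Delta> - 1))"
  define ls where "ls P = sorted_list_of_multiset P" for P :: "nat multiset"
  define M where "M P = gain_vector_matroid r (weights (ls P))" for P
  have mset_ls: "mset (ls P) = P" for P by (simp add: ls_def)
  have Q: "0 \<notin> set (ls P)" "sum_list (ls P) = \<Delta>" "length (ls P) < r" if "P \<in> Q" for P
  proof -
    have "0 \<notin># P" "sum_mset P = \<Delta>" using that assms(1) by (auto simp: Q_def partitions_def)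
    then have "0 \<notin># mset (ls P)" "sum_mset (mset (ls P)) = \<Delta>" by (simp_all only: mset_ls not_False_eq_True)
    then show *: "0 \<notin> set (ls P)" "sum_list (ls P) = \<Delta>" by (simp_all add: sum_mset_sum_list)
    \<comment> \<open>There are at most \<Delta> parts, so they fit on the \<open>r - 1\<close>
      vertices other than 0.\<close>
    show "length (ls P) < r" using length_le_sum_list[OF *(1)] *(2) assms(3) by simp
  qed
  have iso_eq: "P = P'" if "P \<in> Q" "P' \<in> Q" "matroid_iso (M P) (M P')" for P P'
    using gain_vector_matroid_iso_imp_mset_eq[OF that(3)[unfolded M_def]] Q[OF that(1)] Q[OF that(2)] mset_ls
    by metis
  have refl: "matroid_iso N N" for N :: "nat indep_system"
    unfolding matroid_iso_def by (intro exI[of _ id]) auto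
  have "inj_on M Q"
  proof (rule inj_onI)
    fix P P' assume "P \<in> Q" "P' \<in> Q" "M P = M P'"
    then show "P = P'" using iso_eq[of P P'] refl[of "M P"] by simp
  qed
  moreover have "card Q = num_partitions (\<Delta> - 1) + 1"
  proof -
    have "{#\<Delta>#} \<notin> add_mset 1 ` partitions (\<Delta> - 1)"
      using assms(1) by (auto simp: add_mset_eq_single)
    moreover have "card (add_mset 1 ` partitions (\<Delta> - 1)) = num_partitions (\<Delta> - 1)"
      by (subst card_image) (auto simp: num_partitions_def partitions_def inj_on_def)
    ultimately show ?thesis using finite_partitions by (simp add: Q_def)
  qed
  moreover have "finite Q" using finite_partitions by (simp add: Q_def)
  moreover have "matroid (M P) \<and> simple_matroid (M P) \<and> matroid_rank (M P) = r \<and> modular_matroid \<Delta> (M P)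
      \<and> card (ground (M P)) = ((r + 1) choose 2) + (\<Delta> - 1) * (r - 1)" if P: "P \<in> Q" for P
  proof (intro conjI)
    let ?c = "weights (ls P)"
    have r: "0 < r" using assms(2) by simp
    have sum: "(\<Sum>i<r. ?c i) = \<Delta>" using sum_weights Q[OF P] by simp
    show "matroid (M P)" by (simp add: M_def matroid_vector_matroid)
    show "simple_matroid (M P)" using simple_gain_vector_matroid[OF r] by (simp add: M_def)
    show "matroid_rank (M P) = r"
      using gain_vector_matroid_basis[OF r, of ?c]
        matroid_rank_vector_matroid[of _ "map_mat real_of_int (gain_mat r ?c)"] by (auto simp: M_def)
    have "modular_mat \<Delta> (gain_mat r ?c)"
      using r sum assms(1) by (intro modular_gain_mat) (simp_all add: weights_def)
    then show "modular_matroid \<Delta> (M P)"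
      unfolding modular_matroid_def M_def using refl by blast
    have "card (ground (M P)) = card (gain_elements r ?c)"
      using distinct_card[OF gain_list(1)] gain_list(2) by (metis M_def card_lessThan dim_gain_mat(2)
        ground_vector_matroid index_map_mat(3))
    also have "\<dots> = 1 + (r choose 2) + (r - 1) * \<Delta>" by (simp add: card_gain_elements sum)
    \<comment> \<open>\<open>(r + 1) choose 2\<close> exceeds \<open>r choose 2\<close> by
      \<open>r\<close>, which is the apex plus one of the \<Delta> multiples of
      \<open>r - 1\<close>.\<close>
    also have "\<dots> = ((r + 1) choose 2) + (\<Delta> - 1) * (r - 1)"
    proof -
      obtain q D where "r = Suc q" "\<Delta> = Suc D" using assms by (cases r; cases \<Delta>) auto
      then show ?thesis by (simp add: numeral_2_eq_2)
    qed
    finally show "card (ground (M P)) = ((r + 1) choose 2) + (\<Delta> - 1) * (r - 1)" .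
  qed
  ultimately show ?thesis
    using iso_eq by (intro exI[of _ "M ` Q"]) (auto simp: card_image)
qed

end
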